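(* Let $X_1,X_2,\dots$ be independent identically distributed real random variables having a density (with respect to Lebesgue measure), with $\mathbb{E}X_1=0$ and $\mathbb{E}X_1^2=1$. Put $S_n:=\sum_{k=1}^n X_k$ and $\overline{S}_n:=\max_{k=1,\dots,n}S_k$, and let $Z$ be a standard normal random variable. Then $$d_{TV}(\overline{S}_n/\sqrt{n},|Z|)\to 0\qquad\text{as } n\to\infty .$$
   Context: $d_{TV}(X,Y)$ denotes the total variation distance between the distributions of the random variables $X$ and $Y$, i.e. the total variation norm of the difference of their distributions (equal to $\int_{\mathbb{R}}|p_X-p_Y|\,dx$ when $X,Y$ have densities $p_X,p_Y$); a different constant normalization does not affect the statement. *)

theory Defs
  imports "HOL-Probability.Probability"
begin

(* Total variation norm of the signed measure \<mu> - \<nu>: the supremum of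
   (\<Sum>A. \<bar>\<mu> A - \<nu> A\<bar>) over finite measurable partitions of the space.  No factor 1/2, so it
   agrees with the L1-distance of densities.  It is meant for finite measures with equal
   sigma-algebras: the sums are then bounded by \<mu>(space) + \<nu>(space), so the real
   supremum is the true one. *)
definition tv_norm_diff :: "'a measure \<Rightarrow> 'a measure \<Rightarrow> real" where
  "tv_norm_diff \<mu> \<nu> =
     (SUP P\<in>{P. finite P \<and> P \<subseteq> sets \<mu> \<and> partition_on (space \<mu>) P}.
        \<Sum>A\<in>P. \<bar>measure \<mu> A - measure \<nu> A\<bar>)"

(* The two random variables may live on different probability spaces. *)
definition d_TV :: "'a measure \<Rightarrow> ('a \<Rightarrow> real) \<Rightarrow> 'b measure \<Rightarrow> ('b \<Rightarrow> real) \<Rightarrow> real" where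
  "d_TV M X N Y = tv_norm_diff (distr M borel X) (distr N borel Y)"

definition partial_sum :: "(nat \<Rightarrow> 'a \<Rightarrow> real) \<Rightarrow> nat \<Rightarrow> 'a \<Rightarrow> real" where
  "partial_sum X n \<omega> = (\<Sum>k=1..n. X k \<omega>)"

(* The maximum starts at k = 1 and so can be negative; only n \<ge> 1 is meaningful. *)
definition max_partial_sum :: "(nat \<Rightarrow> 'a \<Rightarrow> real) \<Rightarrow> nat \<Rightarrow> 'a \<Rightarrow> real" where
  "max_partial_sum X n \<omega> = Max ((\<lambda>k. partial_sum X k \<omega>) ` {1..n})"

end

theory Submission
  imports Defs
begin

text \<open>
Let \<open>W\<^sub>n = max 0 S\<^sub>1 \<dots> S\<^sub>n\<close>.  The maximum of the partial sums differs from \<open>W\<^sub>n\<close> only on an event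
contained in \<open>W\<^sub>n = 0\<close>, whose probability tends to \<open>0\<close>; so it is enough to treat \<open>W\<^sub>n\<close>.  Convergence
in total variation follows from two facts: the distribution functions converge, and the laws of
\<open>W\<^sub>n / sqrt n\<close> are asymptotically continuous under translations in total variation.

\<^bold>\<open>Convergence of the distribution functions.\<close>  Conditioning on the first step shows that
\<open>v\<^sub>n y = P (W\<^sub>n \<le> y)\<close> satisfies \<open>v\<^sub>n\<^sub>+\<^sub>1 y = E (v\<^sub>n (y - X))\<close> for \<open>y \<ge> 0\<close> and \<open>v\<^sub>n y = 0\<close> for
\<open>y < 0\<close>: a discrete heat equation on the half line with absorption at \<open>0\<close>.  Its continuous
counterpart is solved by \<open>H s y = half_normal (y / sqrt s)\<close>, where \<open>half_normal u = P (\<bar>Z\<bar> \<le> u)\<close> for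
\<open>u \<ge> 0\<close>, continued to an odd function.  A Taylor expansion (\<open>heat_step\<close>) shows that averaging
\<open>H s\<close> over one step of the walk gives \<open>H (s + 1)\<close> up to \<open>o (1 / n)\<close>, uniformly in \<open>s \<ge> \<epsilon> n\<close>.
The discrete recursion is monotone, \<open>H\<close> is nonpositive left of the boundary, and a slightly
translated and raised copy of \<open>H\<close> lies above the initial value; hence \<open>H\<close> and that copy enclose
\<open>v\<^sub>n\<close> (\<open>max_cdf_lower\<close>, \<open>max_cdf_upper\<close>), and \<open>P (W\<^sub>n \<le> x sqrt n)\<close> tends to \<open>half_normal x\<close>
(\<open>max_cdf_limit\<close>).

\<^bold>\<open>Translations.\<close>  For every small \<open>d > 0\<close> the density of a step dominates the average of a function
\<open>\<nu>\<close> and its translate by \<open>d\<close>, with the mass of \<open>\<nu>\<close> bounded below (\<open>common_part_of_shifts\<close>).  A step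
thus contains, with fixed probability, an independent fair choice between \<open>0\<close> and \<open>d\<close>, and the
binomial number of such choices among \<open>m\<close> steps makes the law of \<open>S\<^sub>m\<close> change by only
\<open>O (1 / sqrt m)\<close> under translation by \<open>d\<close>, hence by \<open>O (t + 1 / sqrt m)\<close> under translation by
\<open>t sqrt m\<close> (\<open>shift_bound\<close>).  With \<open>m\<close> a small fixed fraction of \<open>n\<close>, the maximum is attained after
time \<open>m\<close> with probability close to one (\<open>early_maximum_unlikely\<close>), and then \<open>W\<^sub>n\<close> is \<open>S\<^sub>m\<close> plus an
independent variable; so its law inherits the continuity (\<open>asymptotic_shift_continuity\<close>).

\<^bold>\<open>Conclusion.\<close>  Adding an independent uniform variable on \<open>[0, h]\<close> changes the laws little, by
translation continuity, and produces the densities \<open>(F x - F (x - h)) / h\<close>, which are determined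
by the distribution functions \<open>F\<close> and therefore converge pointwise.  By Scheffe's lemma they converge
in \<open>L\<^sup>1\<close> (\<open>cdf_convergence_imp_uniform_on_sets\<close>).
\<close>


section \<open>Bounding the total variation norm\<close>

text \<open>
In a partition, group the cells by the sign of the difference of the two measures; each of the two
unions is a single measurable set and contributes at most \<open>e\<close>.
\<close>
lemma tv_norm_diff_bounds:
  fixes \<mu> \<nu> :: "'a measure"
  assumes "finite_measure \<mu>" and "finite_measure \<nu>" and sets: "sets \<nu> = sets \<mu>"
    and e: "\<And>A. A \<in> sets \<mu> \<Longrightarrow> \<bar>measure \<mu> A - measure \<nu> A\<bar> \<le> e"
  shows "0 \<le> tv_norm_diff \<mu> \<nu>" and "tv_norm_diff \<mu> \<nu> \<le> 2 * e"
proof -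
  interpret \<mu>: finite_measure \<mu> by fact
  interpret \<nu>: finite_measure \<nu> by fact
  let ?P = "{P. finite P \<and> P \<subseteq> sets \<mu> \<and> partition_on (space \<mu>) P}"
  let ?s = "\<lambda>P. \<Sum>A\<in>P. \<bar>measure \<mu> A - measure \<nu> A\<bar>"
  have bound: "?s P \<le> 2 * e" if "P \<in> ?P" for P
  proof -
    have P: "finite P" "P \<subseteq> sets \<mu>" "disjoint P"
      using that by (auto simp: partition_on_def)
    define Q where "Q = {A\<in>P. measure \<nu> A \<le> measure \<mu> A}"
    define R where "R = P - Q"
    have fin: "finite Q" "finite R" "Q \<subseteq> sets \<mu>" "R \<subseteq> sets \<mu>" "Q \<inter> R = {}" "P = Q \<union> R"
      using P by (auto simp: Q_def R_def)
    have dis: "disjoint_family_on (\<lambda>A. A) Q" "disjoint_family_on (\<lambda>A. A) R"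
      using P(3) by (auto simp: Q_def R_def disjoint_family_on_def disjoint_def)
    have mQ: "measure \<mu> (\<Union>Q) = (\<Sum>A\<in>Q. measure \<mu> A)" "measure \<nu> (\<Union>Q) = (\<Sum>A\<in>Q. measure \<nu> A)"
      using \<mu>.finite_measure_finite_Union[OF fin(1) _ dis(1)]
        \<nu>.finite_measure_finite_Union[OF fin(1) _ dis(1)] fin sets by auto
    have mR: "measure \<mu> (\<Union>R) = (\<Sum>A\<in>R. measure \<mu> A)" "measure \<nu> (\<Union>R) = (\<Sum>A\<in>R. measure \<nu> A)"
      using \<mu>.finite_measure_finite_Union[OF fin(2) _ dis(2)]
        \<nu>.finite_measure_finite_Union[OF fin(2) _ dis(2)] fin sets by auto
    have "?s P = ?s Q + ?s R"
      unfolding fin(6) using fin by (intro sum.union_disjoint) auto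
    also have "?s Q = measure \<mu> (\<Union>Q) - measure \<nu> (\<Union>Q)"
      unfolding mQ sum_subtractf[symmetric] by (intro sum.cong) (auto simp: Q_def)
    also have "?s R = measure \<nu> (\<Union>R) - measure \<mu> (\<Union>R)"
      unfolding mR sum_subtractf[symmetric] by (intro sum.cong) (auto simp: Q_def R_def)
    finally show ?thesis
      using e[of "\<Union>Q"] e[of "\<Union>R"] fin sets.finite_Union[of Q \<mu>] sets.finite_Union[of R \<mu>] by auto
  qed
  have bdd: "bdd_above (?s ` ?P)"
    using bound by (intro bdd_aboveI2) auto
  define P0 where "P0 = (if space \<mu> = {} then {} else {space \<mu>})"
  have P0: "P0 \<in> ?P"
    by (auto simp: P0_def partition_on_def)
  have "0 \<le> ?s P0" by (intro sum_nonneg) auto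
  also have "?s P0 \<le> tv_norm_diff \<mu> \<nu>"
    unfolding tv_norm_diff_def by (intro cSUP_upper P0 bdd)
  finally show "0 \<le> tv_norm_diff \<mu> \<nu>" .
  show "tv_norm_diff \<mu> \<nu> \<le> 2 * e"
    unfolding tv_norm_diff_def using P0 bound by (intro cSUP_least) auto
qed

section \<open>Differences of binomially averaged translates\<close>

text \<open>
With \<open>V g x = g (x + d)\<close>, this is the operator \<open>((1 + V) / 2)\<^sup>j (1 - V)\<close> applied to \<open>g\<close>: the difference
between \<open>g\<close> and its translate, averaged over \<open>j\<close> fair choices between the displacements \<open>0\<close> and \<open>d\<close>.
\<close>
primrec avg_diff :: "nat \<Rightarrow> real \<Rightarrow> (real \<Rightarrow> real) \<Rightarrow> real \<Rightarrow> real" where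
  "avg_diff 0 d g = (\<lambda>x. g x - g (x + d))"
| "avg_diff (Suc j) d g = avg_diff j d (\<lambda>x. (g x + g (x + d)) / 2)"

lemma avg_diff_binomial:
  "2 ^ j * avg_diff j d g x =
    (\<Sum>i\<le>j. real (j choose i) * g (x + real i * d)) -
    (\<Sum>i\<le>j. real (j choose i) * g (x + real (Suc i) * d))"
proof (induction j arbitrary: g)
  case 0
  then show ?case by simp
next
  case (Suc j)
  have *: "(\<Sum>i\<le>Suc j. real (Suc j choose i) * h i) =
     (\<Sum>i\<le>j. real (j choose i) * h i) + (\<Sum>i\<le>j. real (j choose i) * h (Suc i))" for h :: "nat \<Rightarrow> real"
  proof -
    have "(\<Sum>i\<le>Suc j. real (Suc j choose i) * h i) = h 0 + (\<Sum>i\<le>j. real (Suc j choose Suc i) * h (Suc i))"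
      by (subst sum.atMost_Suc_shift) simp
    also have "\<dots> = h 0 + (\<Sum>i\<le>j. real (j choose Suc i) * h (Suc i)) + (\<Sum>i\<le>j. real (j choose i) * h (Suc i))"
      by (simp add: distrib_right sum.distrib)
    also have "h 0 + (\<Sum>i\<le>j. real (j choose Suc i) * h (Suc i)) = (\<Sum>i\<le>Suc j. real (j choose i) * h i)"
      by (subst sum.atMost_Suc_shift) simp
    also have "\<dots> = (\<Sum>i\<le>j. real (j choose i) * h i)" by (simp add: binomial_eq_0)
    finally show ?thesis .
  qed
  have "2 ^ Suc j * avg_diff (Suc j) d g x = 2 * (2 ^ j * avg_diff j d (\<lambda>x. (g x + g (x + d)) / 2) x)"
    by simp
  also have "\<dots> = (\<Sum>i\<le>Suc j. real (Suc j choose i) * g (x + real i * d)) -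
      (\<Sum>i\<le>Suc j. real (Suc j choose i) * g (x + real (Suc i) * d))"
    unfolding Suc.IH * [of "\<lambda>i. g (x + real i * d)"] *[of "\<lambda>i. g (x + real (Suc i) * d)"]
    by (simp add: sum_distrib_left algebra_simps sum.distrib sum_subtractf[symmetric])
      (intro sum.cong refl, simp add: field_simps)
  finally show ?case .
qed

text \<open>
The mean absolute deviation of a symmetric binomial variable is at most its standard deviation; the
moments are read off the Bernstein polynomials at \<open>1/2\<close>.
\<close>
lemma sum_binomial_abs_le:
  "(\<Sum>i\<le>m. \<bar>real m - 2 * real i\<bar> * real (m choose i)) \<le> 2 ^ m * sqrt (real m)"
proof -
  have B: "real (m choose i) = 2 ^ m * Bernstein m i (1/2)" if "i \<le> m" for i
  proof -
    have "(1/2::real) ^ i * (1 - 1/2) ^ (m - i) = (1/2) ^ m"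
      using that by (simp add: power_add[symmetric])
    then show ?thesis by (simp add: Bernstein_def mult.assoc power_divide)
  qed
  have Bern: "(\<Sum>i\<le>m. h i * real (m choose i)) = 2 ^ m * (\<Sum>i\<le>m. h i * Bernstein m i (1/2))" for h
    unfolding sum_distrib_left by (intro sum.cong) (auto simp: B)
  have k1: "(\<Sum>i\<le>m. real i * real (m choose i)) = 2 ^ m * (real m / 2)"
    unfolding Bern by simp
  have k2: "(\<Sum>i\<le>m. real i * (real i - 1) * real (m choose i)) = 2 ^ m * (real m * (real m - 1) / 4)"
    unfolding Bern by (simp add: power2_eq_square)
  have k0: "(\<Sum>i\<le>m. real (m choose i)) = 2 ^ m"
    using choose_row_sum[of m] by (metis of_nat_numeral of_nat_power of_nat_sum)
  have "(\<Sum>i\<le>m. (real m - 2 * real i)\<^sup>2 * real (m choose i)) =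
     (\<Sum>i\<le>m. (real m)\<^sup>2 * real (m choose i) + (4 - 4 * real m) * (real i * real (m choose i))
        + 4 * (real i * (real i - 1) * real (m choose i)))"
    by (intro sum.cong) (auto simp: power2_eq_square algebra_simps)
  also have "\<dots> = (real m)\<^sup>2 * 2 ^ m + (4 - 4 * real m) * (2 ^ m * (real m / 2))
       + 4 * (2 ^ m * (real m * (real m - 1) / 4))"
    by (simp only: sum.distrib sum_distrib_left[symmetric] k0 k1 k2)
  also have "\<dots> = 2 ^ m * real m" by (simp add: power2_eq_square field_simps)
  finally have var: "(\<Sum>i\<le>m. (real m - 2 * real i)\<^sup>2 * real (m choose i)) = 2 ^ m * real m" .
  have "(\<Sum>i\<le>m. \<bar>real m - 2 * real i\<bar> * real (m choose i))\<^sup>2 =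
     (\<Sum>i\<le>m. (\<bar>real m - 2 * real i\<bar> * sqrt (real (m choose i))) * sqrt (real (m choose i)))\<^sup>2"
    by (simp add: mult.assoc)
  also have "\<dots> \<le> (\<Sum>i\<le>m. (\<bar>real m - 2 * real i\<bar> * sqrt (real (m choose i)))\<^sup>2) *
     (\<Sum>i\<le>m. (sqrt (real (m choose i)))\<^sup>2)"
    by (rule Cauchy_Schwarz_ineq_sum)
  also have "\<dots> = (2 ^ m * sqrt (real m))\<^sup>2"
    by (simp add: power_mult_distrib k0 var) (simp add: power2_eq_square)
  finally show ?thesis
    by (rule power2_le_imp_le) simp
qed

text \<open>
Translation by \<open>d\<close> shifts the binomial weights by one index, and successive binomial coefficients of
order \<open>j\<close> differ by \<open>(j + 1 - 2 i) / (j + 1)\<close> times a coefficient of order \<open>j + 1\<close>.  The total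
variation between the two weight sequences is therefore a mean absolute deviation, of order
\<open>1 / sqrt j\<close>.
\<close>
lemma avg_diff_bound:
  assumes g: "\<And>x. \<bar>g x\<bar> \<le> c"
  shows "\<bar>avg_diff j d g x\<bar> \<le> 2 * c / sqrt (1 + real j)"
proof -
  let ?m = "Suc j" and ?g = "\<lambda>i. g (x + real i * d)"
  have c: "0 \<le> c" using g[of 0] by linarith
  have a: "real ?m * real (j choose i) = (real ?m - real i) * real (?m choose i)" if "i \<le> j" for i
  proof -
    have "(?m - i) * (?m choose i) = ?m * (j choose i)"
      using binomial_absorb_comp[of ?m i] by simp
    then have "real (?m - i) * real (?m choose i) = real ?m * real (j choose i)"
      by (metis of_nat_mult)
    then show ?thesis using that by (simp add: of_nat_diff)
  qed
  have b: "real ?m * real (j choose i) = real (Suc i) * real (?m choose Suc i)" for i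
    using Suc_times_binomial_eq[of j i] by (metis mult.commute of_nat_mult)
  have "real ?m * (2 ^ j * avg_diff j d g x) =
     (\<Sum>i\<le>j. real ?m * real (j choose i) * ?g i) - (\<Sum>i\<le>j. real ?m * real (j choose i) * ?g (Suc i))"
    unfolding avg_diff_binomial right_diff_distrib sum_distrib_left by (simp only: mult.assoc)
  also have "(\<Sum>i\<le>j. real ?m * real (j choose i) * ?g i) = (\<Sum>i\<le>j. (real ?m - real i) * real (?m choose i) * ?g i)"
    by (intro sum.cong refl) (simp only: a atMost_iff)
  also have "\<dots> = (\<Sum>i\<le>?m. (real ?m - real i) * real (?m choose i) * ?g i)"
    by simp
  also have "(\<Sum>i\<le>j. real ?m * real (j choose i) * ?g (Suc i)) = (\<Sum>i\<le>j. real (Suc i) * real (?m choose Suc i) * ?g (Suc i))"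
    by (simp only: b)
  also have "\<dots> = (\<Sum>i\<le>?m. real i * real (?m choose i) * ?g i)"
    by (subst sum.atMost_Suc_shift) simp
  also have "(\<Sum>i\<le>?m. (real ?m - real i) * real (?m choose i) * ?g i) - (\<Sum>i\<le>?m. real i * real (?m choose i) * ?g i) =
     (\<Sum>i\<le>?m. (real ?m - 2 * real i) * real (?m choose i) * ?g i)"
    unfolding sum_subtractf[symmetric] by (intro sum.cong refl) (simp add: algebra_simps)
  finally have E: "real ?m * (2 ^ j * avg_diff j d g x) = (\<Sum>i\<le>?m. (real ?m - 2 * real i) * real (?m choose i) * ?g i)" .
  have "real ?m * 2 ^ j * \<bar>avg_diff j d g x\<bar> = \<bar>real ?m * (2 ^ j * avg_diff j d g x)\<bar>"
    by (simp only: abs_mult abs_of_nat power_abs abs_numeral mult.assoc)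
  also have "\<dots> = \<bar>\<Sum>i\<le>?m. (real ?m - 2 * real i) * real (?m choose i) * ?g i\<bar>"
    unfolding E ..
  also have "\<dots> \<le> (\<Sum>i\<le>?m. \<bar>real ?m - 2 * real i\<bar> * real (?m choose i) * c)"
    by (intro order_trans[OF sum_abs] sum_mono) (auto simp: abs_mult intro!: mult_left_mono g)
  also have "\<dots> \<le> (2 ^ ?m * sqrt (real ?m)) * c"
    unfolding sum_distrib_right[symmetric] by (intro mult_right_mono sum_binomial_abs_le c)
  also have "\<dots> = 2 ^ ?m * (real ?m / sqrt (real ?m)) * c"
    by (simp only: real_div_sqrt of_nat_0_le_iff)
  also have "\<dots> = real ?m * 2 ^ j * (2 * c / sqrt (real ?m))"
    by simp
  finally have "\<bar>avg_diff j d g x\<bar> \<le> 2 * c / sqrt (real ?m)"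
    by (rule mult_left_le_imp_le) simp
  then show ?thesis by simp
qed

lemma borel_measurable_avg_diff [measurable]:
  assumes [measurable]: "g \<in> borel_measurable borel"
  shows "avg_diff j d g \<in> borel_measurable borel"
  using assms
proof (induction j arbitrary: g)
  case 0
  note 0[measurable]
  show ?case by simp
next
  case (Suc j)
  note Suc.prems[measurable]
  have "(\<lambda>x. (g x + g (x + d)) / 2) \<in> borel_measurable borel" by measurable
  from Suc.IH[OF this] show ?case by simp
qed

lemma avg_diff_add: "avg_diff j d (\<lambda>x. g x + h x) x = avg_diff j d g x + avg_diff j d h x"
proof (induction j arbitrary: g h)
  case (Suc j)
  have "(\<lambda>x. (g x + h x + (g (x + d) + h (x + d))) / 2) = (\<lambda>x. (g x + g (x + d)) / 2 + (h x + h (x + d)) / 2)"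
    by (auto simp: field_simps)
  then show ?case using Suc[of "\<lambda>x. (g x + g (x + d)) / 2" "\<lambda>x. (h x + h (x + d)) / 2"] by simp
qed simp

text \<open>
If \<open>1 / sqrt s\<close> bounds the effect of a translation and a step raises \<open>s\<close> by one with probability
\<open>p\<close>, then the expected new bound is at most the old bound with \<open>s\<close> raised by \<open>p / 2\<close>.  Convexity
of \<open>1 / sqrt s\<close> excludes the increment \<open>p\<close>, and \<open>s \<ge> 1\<close> leaves room for half of it.
\<close>
lemma shift_step_ineq:
  fixes s p :: real
  assumes s: "1 \<le> s" and p: "0 \<le> p" "p \<le> 1"
  shows "p / sqrt (s + 1) + (1 - p) / sqrt s \<le> 1 / sqrt (s + p / 2)"
proof -
  have key: "1 / sqrt s - 1 / sqrt (s + q) = q / (sqrt s * sqrt (s + q) * (sqrt s + sqrt (s + q)))"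
    if "0 \<le> q" for q
  proof -
    have pos: "0 < sqrt s" "0 < sqrt (s + q)" using s that by auto
    then have ne: "sqrt s + sqrt (s + q) \<noteq> 0" by linarith
    have "(sqrt (s + q) - sqrt s) * (sqrt s + sqrt (s + q)) = q"
      using s that by (simp add: algebra_simps)
    then have "sqrt (s + q) - sqrt s = q / (sqrt s + sqrt (s + q))"
      using ne by (simp add: eq_divide_eq)
    moreover have "1 / sqrt s - 1 / sqrt (s + q) = (sqrt (s + q) - sqrt s) / (sqrt s * sqrt (s + q))"
      using pos by (simp add: diff_frac_eq)
    ultimately show ?thesis by (simp add: mult.commute)
  qed
  have "1 / sqrt s - 1 / sqrt (s + p / 2) = (p/2) / (sqrt s * sqrt (s + p/2) * (sqrt s + sqrt (s + p/2)))"
    using key[of "p/2"] p by simp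
  also have "\<dots> \<le> (p/2) / (sqrt s * sqrt s * (sqrt s + sqrt s))"
    using s p by (intro divide_left_mono mult_mono add_mono) (auto intro!: mult_pos_pos add_pos_pos)
  also have "\<dots> = p / (4 * (s * sqrt s))" using s by (simp add: field_simps)
  also have "\<dots> \<le> p / (2 * ((s + 1) * sqrt s))"
  proof (intro divide_left_mono)
    show "2 * ((s + 1) * sqrt s) \<le> 4 * (s * sqrt s)"
      using mult_right_mono[of "s + 1" "2 * s" "sqrt s"] s by simp
    show "0 < 4 * (s * sqrt s) * (2 * ((s + 1) * sqrt s))"
      using s by (intro mult_pos_pos) auto
  qed (use p in auto)
  also have "\<dots> = p * (1 / (sqrt s * sqrt (s + 1) * (sqrt (s + 1) + sqrt (s + 1))))"
    using s by (simp add: field_simps flip: real_sqrt_mult_self[of "s + 1"])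
  also have "\<dots> \<le> p * (1 / (sqrt s * sqrt (s + 1) * (sqrt s + sqrt (s + 1))))"
    using s p by (intro mult_left_mono divide_left_mono mult_mono add_mono) (auto intro!: mult_pos_pos add_pos_pos)
  also have "\<dots> = p * (1 / sqrt s - 1 / sqrt (s + 1))"
    using key[of 1] by simp
  finally show ?thesis by (simp add: diff_divide_distrib right_diff_distrib)
qed

section \<open>The common part of a density and its small translates\<close>

text \<open>
Some level set of \<open>f\<close> has positive finite measure and hence contains a compact set \<open>K\<close> of positive
measure.  If \<open>U\<close> is an open neighbourhood of \<open>K\<close> with measure less than \<open>3/2\<close> that of \<open>K\<close>, then a
small translate of \<open>K\<close> still lies in \<open>U\<close> and so overlaps \<open>K\<close> in at least half of its measure (the
argument of Steinhaus).  A multiple of the indicator of the overlap serves as \<open>\<nu>\<close>.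
\<close>
lemma common_part_of_shifts:
  fixes f :: "real \<Rightarrow> real"
  assumes f [measurable]: "f \<in> borel_measurable borel" and f0: "\<And>x. 0 \<le> f x"
    and f1: "integral\<^sup>L lborel f = 1"
  obtains d0 p where "0 < d0" "0 < p"
    "\<And>d. 0 < d \<Longrightarrow> d \<le> d0 \<Longrightarrow> \<exists>\<nu>. \<nu> \<in> borel_measurable borel \<and> integrable lborel \<nu> \<and> (\<forall>y. 0 \<le> \<nu> y) \<and>
       (\<forall>y. (\<nu> y + \<nu> (y - d)) / 2 \<le> f y) \<and> p \<le> integral\<^sup>L lborel \<nu>"
proof -
  (* Truncation to a bounded interval makes the level sets finite in measure. *)
  define A where "A n = {x. 1 / real (Suc n) \<le> f x} \<inter> {- real n..real n}" for n
  have A [measurable]: "A n \<in> sets borel" for n unfolding A_def by measurable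
  have "\<exists>n. emeasure lborel (A n) \<noteq> 0"
  proof (rule ccontr)
    assume "\<not> ?thesis"
    then have "A n \<in> null_sets lborel" for n by (auto simp: null_sets_def)
    then have null: "(\<Union>n. A n) \<in> null_sets lborel" by auto
    have "f x = 0" if "x \<notin> (\<Union>n. A n)" for x
    proof (rule ccontr)
      assume "f x \<noteq> 0"
      then have "0 < f x" using f0[of x] by linarith
      then obtain n where n: "1 / real (Suc n) < f x" using nat_approx_posE by metis
      obtain m :: nat where m: "\<bar>x\<bar> \<le> real m" using real_arch_simple by blast
      have "1 / real (Suc (max n m)) \<le> 1 / real (Suc n)" by (intro divide_left_mono) auto
      then have "x \<in> A (max n m)" using n m unfolding A_def by auto
      with that show False by auto
    qed
    then have "AE x in lborel. f x = 0"
      using null by (intro AE_I'[OF null]) auto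
    then have "integral\<^sup>L lborel f = 0"
      by (rule integral_eq_zero_AE)
    with f1 show False by simp
  qed
  then obtain n where n: "emeasure lborel (A n) \<noteq> 0" by blast
  have "emeasure lborel (A n) \<le> emeasure lborel {- real n..real n}"
    by (intro emeasure_mono) (auto simp: A_def)
  also have "\<dots> < \<infinity>" by simp
  finally have fin: "emeasure lborel (A n) < \<infinity>" .
  define a where "a = measure lborel (A n)"
  have a: "0 < a" "emeasure lborel (A n) = ennreal a"
    using n fin unfolding a_def measure_def
    by (cases "emeasure lborel (A n)" rule: ennreal_cases; simp add: less_le ennreal_eq_0_iff)+
  obtain K where K: "closed K" "K \<subseteq> A n" "A n - K \<in> lmeasurable" "emeasure lebesgue (A n - K) < ennreal (a/2)"
    using sets_lebesgue_inner_closed[of "A n" "a/2"] a A by auto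
  have Kb: "K \<in> sets borel" using K by auto
  have Kc: "compact K"
  proof -
    have "K \<inter> {- real n..real n} = K" using K(2) by (auto simp: A_def)
    then show ?thesis using closed_Int_compact[OF K(1) compact_Icc, of "- real n" "real n"] by simp
  qed
  have mlt: "measure lborel B < e" if "emeasure lborel B < ennreal e" "0 < e" for B :: "real set" and e
    using that by (cases "emeasure lborel B" rule: ennreal_cases) (auto simp: measure_def ennreal_less_iff)
  have AK: "emeasure lborel (A n - K) < ennreal (a/2)"
    using K(4) Kb A by simp
  have finK: "emeasure lborel K < \<infinity>"
    by (rule le_less_trans[OF emeasure_mono[OF K(2)] fin]) auto
  have "measure lborel (A n - K) < a / 2"
    using AK a(1) by (intro mlt) auto
  moreover have "measure lborel (A n - K) = measure lborel (A n) - measure lborel K"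
    using fin Kb A K(2) by (intro measure_Diff) auto
  ultimately have mK: "a / 2 < measure lborel K" unfolding a_def by linarith
  define k where "k = measure lborel K"
  have k: "0 < k" "emeasure lborel K = ennreal k"
    using mK a(1) finK unfolding k_def measure_def
    by (cases "emeasure lborel K" rule: ennreal_cases; simp)+
  obtain U where U: "open U" "K \<subseteq> U" "emeasure lborel (U - K) < ennreal (k/2)"
    using outer_regular_lborel[OF Kb, of "k/2"] k by auto
  have Ub: "U \<in> sets borel" using U by auto
  obtain r where r: "0 < r" "\<And>x y. x \<in> K \<Longrightarrow> y \<in> - U \<Longrightarrow> r \<le> dist x y"
    using separate_compact_closed[of K "- U"] Kc U by blast
  have near: "y \<in> U" if "x \<in> K" "dist x y < r" for x y
    using r(2)[of x y] that by force
  define c where "c = 1 / real (Suc n)"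
  have c: "0 < c" "\<And>x. x \<in> K \<Longrightarrow> c \<le> f x"
    using K(2) unfolding A_def c_def by auto
  show ?thesis
  proof (rule that[of "r/2" "c * (k/2)"])
    show "0 < r/2" "0 < c * (k/2)" using r c k by auto
    fix d :: real assume d: "0 < d" "d \<le> r/2"
    define Kd where "Kd = (\<lambda>y. y + d) -` K"
    have Kdb [measurable]: "Kd \<in> sets borel"
      unfolding Kd_def using measurable_sets[of "\<lambda>y::real. y + d" borel borel K] Kb by simp
    note Kb [measurable] Ub [measurable]
    have "emeasure lborel Kd = emeasure lborel K"
    proof -
      have "emeasure lborel K = emeasure (distr lborel borel ((+) d)) K"
        by (simp only: lborel_distr_plus)
      also have "\<dots> = emeasure lborel ((+) d -` K \<inter> space lborel)"
        by (rule emeasure_distr) auto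
      also have "(+) d -` K \<inter> space lborel = Kd"
        by (auto simp: Kd_def add.commute)
      finally show ?thesis by simp
    qed
    then have mKd: "emeasure lborel Kd = ennreal k" using k by simp
    have sub: "Kd \<subseteq> U"
    proof
      fix y assume "y \<in> Kd"
      then have "y + d \<in> K" by (simp add: Kd_def)
      moreover have "dist (y + d) y < r" using d r(1) by (simp add: dist_real_def)
      ultimately show "y \<in> U" by (rule near)
    qed
    have "emeasure lborel (Kd - K) \<le> emeasure lborel (U - K)"
      using sub by (intro emeasure_mono) auto
    then have lt: "emeasure lborel (Kd - K) < ennreal (k/2)" using U(3) by simp
    have finI: "emeasure lborel (Kd \<inter> K) < \<infinity>"
      by (rule le_less_trans[OF emeasure_mono finK]) auto
    have "measure lborel (Kd - K) < k/2"
      using lt k(1) by (intro mlt) auto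
    moreover have "measure lborel Kd = measure lborel (Kd - K) + measure lborel (Kd \<inter> K)"
    proof -
      have "emeasure lborel (Kd \<inter> K) \<noteq> \<infinity>" using finI by simp
      moreover have "emeasure lborel (Kd - K) \<noteq> \<infinity>" using lt by auto
      ultimately have "measure lborel ((Kd - K) \<union> (Kd \<inter> K)) = measure lborel (Kd - K) + measure lborel (Kd \<inter> K)"
        by (intro measure_Union) auto
      then show ?thesis by (simp add: Un_Diff_Int)
    qed
    moreover have "measure lborel Kd = k" using mKd k(1) by (simp add: measure_def)
    ultimately have int: "k/2 \<le> measure lborel (Kd \<inter> K)" by linarith
    show "\<exists>\<nu>. \<nu> \<in> borel_measurable borel \<and> integrable lborel \<nu> \<and> (\<forall>y. 0 \<le> \<nu> y) \<and>
       (\<forall>y. (\<nu> y + \<nu> (y - d)) / 2 \<le> f y) \<and> c * (k/2) \<le> integral\<^sup>L lborel \<nu>"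
    proof (intro exI[of _ "\<lambda>y. c * indicator (Kd \<inter> K) y"] conjI allI)
      show "integrable lborel (\<lambda>y. c * indicator (Kd \<inter> K) y)"
        using finI by (intro integrable_mult_right integrable_real_indicator) auto
      show "c * (k/2) \<le> integral\<^sup>L lborel (\<lambda>y. c * indicator (Kd \<inter> K) y)"
        using int c finI by (simp add: Int_commute)
      show "(c * indicator (Kd \<inter> K) y + c * indicator (Kd \<inter> K) (y - d)) / 2 \<le> f y" for y
        using c(1) c(2)[of y] f0[of y] by (auto simp: indicator_def Kd_def)
    qed (use c in auto)
  qed
qed

section \<open>Translating the law of a partial sum\<close>

lemma (in prob_space) indep_var_expectation:
  fixes G :: "real \<times> real \<Rightarrow> real"
  assumes ind: "indep_var borel U borel V"
    and G [measurable]: "G \<in> borel_measurable (borel \<Otimes>\<^sub>M borel)" and c: "\<And>z. \<bar>G z\<bar> \<le> c"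
  shows "expectation (\<lambda>\<omega>. G (U \<omega>, V \<omega>)) = expectation (\<lambda>\<omega>. \<integral>v. G (U \<omega>, v) \<partial>distr M borel V)"
proof -
  have [measurable]: "random_variable borel U" "random_variable borel V"
    and eq: "distr M borel U \<Otimes>\<^sub>M distr M borel V = distr M (borel \<Otimes>\<^sub>M borel) (\<lambda>x. (U x, V x))"
    using ind unfolding indep_var_distribution_eq by auto
  interpret U: prob_space "distr M borel U" by (rule prob_space_distr) simp
  interpret V: prob_space "distr M borel V" by (rule prob_space_distr) simp
  interpret UV: pair_prob_space "distr M borel U" "distr M borel V" ..
  have int: "integrable (distr M borel U \<Otimes>\<^sub>M distr M borel V) G"
    by (intro UV.integrable_const_bound[of _ c]) (auto simp: c)
  have "expectation (\<lambda>\<omega>. G (U \<omega>, V \<omega>)) = integral\<^sup>L (distr M (borel \<Otimes>\<^sub>M borel) (\<lambda>x. (U x, V x))) G"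
    by (subst integral_distr) auto
  also have "\<dots> = (\<integral>u. \<integral>v. G (u, v) \<partial>distr M borel V \<partial>distr M borel U)"
    unfolding eq[symmetric] using int by (rule UV.integral_fst'[symmetric])
  also have "\<dots> = expectation (\<lambda>\<omega>. \<integral>v. G (U \<omega>, v) \<partial>distr M borel V)"
    by (subst integral_distr) auto
  finally show ?thesis .
qed

lemma (in prob_space) expectation_abs_le:
  fixes h :: "'a \<Rightarrow> real"
  assumes "\<And>\<omega>. \<bar>h \<omega>\<bar> \<le> c"
  shows "\<bar>expectation h\<bar> \<le> c"
proof (cases "integrable M h")
  case True
  have "\<bar>expectation h\<bar> \<le> expectation (\<lambda>\<omega>. \<bar>h \<omega>\<bar>)" by (rule integral_abs_bound)
  also have "\<dots> \<le> c" by (rule integral_le_const) (use True assms in auto)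
  finally show ?thesis .
next
  case False
  have "0 \<le> c" using assms[of undefined] by linarith
  then show ?thesis using False by (simp add: not_integrable_integral_eq)
qed

lemma lborel_integral_shift:
  fixes g :: "real \<Rightarrow> real"
  shows "(\<integral>y. g (y + d) \<partial>lborel) = integral\<^sup>L lborel g"
  using lborel_integral_real_affine[of 1 g d] by (simp add: add.commute)

lemma integrable_translate_mult:
  fixes g h :: "real \<Rightarrow> real"
  assumes h: "integrable lborel h"
    and g [measurable]: "g \<in> borel_measurable borel" and c: "\<And>x. \<bar>g x\<bar> \<le> c"
  shows "integrable lborel (\<lambda>y. g (x + y) * h y)"
  using h by (intro Bochner_Integration.integrable_bound[OF integrable_mult_right[of c, OF h]])
    (auto simp: abs_mult intro!: mult_mono order_trans[OF c abs_ge_self])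

text \<open>
Convolution with \<open>f\<close> splits into the part carried by \<open>(\<nu> + \<nu> (\<cdot> - d)) / 2\<close>, which factors through
\<open>(1 + V) / 2\<close>, and a remainder; on bounded functions the two parts have norms \<open>p\<close> and \<open>1 - p\<close>.
\<close>
lemma kernel_decomposition:
  fixes f \<nu> g :: "real \<Rightarrow> real"
  assumes f [measurable]: "f \<in> borel_measurable borel" "integrable lborel f" and f1: "integral\<^sup>L lborel f = 1"
    and \<nu> [measurable]: "\<nu> \<in> borel_measurable borel" "integrable lborel \<nu>" and \<nu>0: "\<And>y. 0 \<le> \<nu> y"
    and le: "\<And>y. (\<nu> y + \<nu> (y - d)) / 2 \<le> f y"
    and g [measurable]: "g \<in> borel_measurable borel" and c: "\<And>x. \<bar>g x\<bar> \<le> c"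
  defines "p \<equiv> integral\<^sup>L lborel \<nu>"
  obtains P Q where "P \<in> borel_measurable borel" "Q \<in> borel_measurable borel"
    "\<And>x. \<bar>P x\<bar> \<le> p * c" "\<And>x. \<bar>Q x\<bar> \<le> (1 - p) * c"
    "\<And>x. (\<integral>y. g (x + y) * f y \<partial>lborel) = (P x + P (x + d)) / 2 + Q x"
proof
  define q where "q y = f y - (\<nu> y + \<nu> (y - d)) / 2" for y
  have q0: "0 \<le> q y" for y using le by (simp add: q_def)
  have [measurable]: "q \<in> borel_measurable borel" unfolding q_def by measurable
  have \<nu>s: "integrable lborel (\<lambda>y. \<nu> (y - d))" "integral\<^sup>L lborel (\<lambda>y. \<nu> (y - d)) = p"
    using lborel_integrable_real_affine[OF \<nu>(2), of 1 "-d"] lborel_integral_shift[of \<nu> "-d"] by (simp_all add: p_def)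
  have qi: "integrable lborel q" unfolding q_def using f \<nu> \<nu>s by auto
  have q1: "integral\<^sup>L lborel q = 1 - p"
    unfolding q_def using f \<nu> \<nu>s f1 by (simp add: p_def)
  define P where "P x = (\<integral>y. g (x + y) * \<nu> y \<partial>lborel)" for x
  define Q where "Q x = (\<integral>y. g (x + y) * q y \<partial>lborel)" for x
  show "P \<in> borel_measurable borel" "Q \<in> borel_measurable borel"
    unfolding P_def Q_def by measurable
  note bint = integrable_translate_mult[OF _ g c]
  have bnd: "\<bar>\<integral>y. g (x + y) * h y \<partial>lborel\<bar> \<le> integral\<^sup>L lborel h * c"
    if h: "integrable lborel h" "\<And>y. 0 \<le> h y" for h x
  proof -
    have "\<bar>\<integral>y. g (x + y) * h y \<partial>lborel\<bar> \<le> (\<integral>y. \<bar>g (x + y) * h y\<bar> \<partial>lborel)"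
      by (rule integral_abs_bound)
    also have "\<dots> \<le> (\<integral>y. h y * c \<partial>lborel)"
    proof (intro integral_mono)
      show "\<bar>g (x + y) * h y\<bar> \<le> h y * c" for y
        using h(2)[of y] mult_left_mono[OF c, of "h y" "x + y"] by (simp add: abs_mult mult.commute)
    qed (use bint[OF h(1)] h in \<open>auto intro!: integrable_abs\<close>)
    finally show ?thesis using h by simp
  qed
  show "\<bar>P x\<bar> \<le> p * c" for x unfolding P_def p_def by (rule bnd) (use \<nu> \<nu>0 in auto)
  show "\<bar>Q x\<bar> \<le> (1 - p) * c" for x unfolding Q_def q1[symmetric] by (rule bnd) (use qi q0 in auto)
  fix x
  have "P (x + d) = (\<integral>y. g (x + (y + d)) * \<nu> ((y + d) - d) \<partial>lborel)"
    by (simp add: P_def algebra_simps)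
  also have "\<dots> = (\<integral>y. g (x + y) * \<nu> (y - d) \<partial>lborel)"
    by (rule lborel_integral_shift[of "\<lambda>y. g (x + y) * \<nu> (y - d)"])
  finally have Pd: "P (x + d) = \<dots>" .
  have "(\<integral>y. g (x + y) * f y \<partial>lborel) =
    (\<integral>y. (g (x + y) * \<nu> y + g (x + y) * \<nu> (y - d)) / 2 + g (x + y) * q y \<partial>lborel)"
    by (intro Bochner_Integration.integral_cong) (auto simp: q_def field_simps)
  also have "\<dots> = (P x + P (x + d)) / 2 + Q x"
    unfolding Pd unfolding P_def Q_def
    using bint[OF \<nu>(2)] bint[OF \<nu>s(1)] bint[OF qi]
    by simp
  finally show "(\<integral>y. g (x + y) * f y \<partial>lborel) = (P x + P (x + d)) / 2 + Q x" .
qed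

text \<open>
Convolution commutes with translations.
\<close>
lemma integral_avg_diff:
  fixes f g :: "real \<Rightarrow> real"
  assumes f: "integrable lborel f"
    and g: "g \<in> borel_measurable borel" and c: "\<And>x. \<bar>g x\<bar> \<le> c"
  shows "(\<integral>y. avg_diff j d g (x + y) * f y \<partial>lborel) = avg_diff j d (\<lambda>x. \<integral>y. g (x + y) * f y \<partial>lborel) x"
  using g c
proof (induction j arbitrary: g)
  case g: (0 g)
  note bint = integrable_translate_mult[OF f g]
  show ?case
    using bint[of x] bint[of "x + d"] by (simp add: left_diff_distrib add.commute add.left_commute)
next
  case (Suc j)
  note g = Suc.prems
  note g(1)[measurable]
  note bint = integrable_translate_mult[OF f g]
  have half: "\<bar>(g x + g (x + d)) / 2\<bar> \<le> c" for x
    using g(2)[of x] g(2)[of "x + d"] by (simp add: abs_le_iff field_simps)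
  have "(\<integral>y. (g (x + y) + g (x + y + d)) / 2 * f y \<partial>lborel) =
      ((\<integral>y. g (x + y) * f y \<partial>lborel) + (\<integral>y. g (x + d + y) * f y \<partial>lborel)) / 2" for x
  proof -
    have "(\<integral>y. (g (x + y) + g (x + y + d)) / 2 * f y \<partial>lborel) =
      (\<integral>y. (g (x + y) * f y + g (x + d + y) * f y) / 2 \<partial>lborel)"
      by (intro Bochner_Integration.integral_cong) (auto simp: algebra_simps)
    then show ?thesis using bint[of x] bint[of "x + d"] by simp
  qed
  then show ?case
    using Suc.IH[of "\<lambda>x. (g x + g (x + d)) / 2"] half by simp
qed

locale iid_walk = prob_space M for M :: "'a measure" +
  fixes X :: "nat \<Rightarrow> 'a \<Rightarrow> real"
  assumes indep: "indep_vars (\<lambda>_. borel) X {1..}"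
    and ident: "\<And>k. 1 \<le> k \<Longrightarrow> distr M borel (X k) = distr M borel (X 1)"
begin

lemma rv_X [measurable]: "1 \<le> k \<Longrightarrow> random_variable borel (X k)"
  using indep by (auto simp: indep_vars_def)

abbreviation \<mu> :: "real measure" where "\<mu> \<equiv> distr M borel (X 1)"

lemma prob_space_\<mu>: "prob_space \<mu>"
  by (rule prob_space_distr) measurable

lemma rv_partial_sum [measurable]: "random_variable borel (partial_sum X n)"
  unfolding partial_sum_def by (intro borel_measurable_sum) auto

lemma partial_sum_Suc: "partial_sum X (Suc n) \<omega> = partial_sum X n \<omega> + X (Suc n) \<omega>"
  by (simp add: partial_sum_def)

text \<open>
Independence of a functional of the past and a functional of the future of the walk, in the form in
which all independence statements below are obtained.
\<close>
lemma indep_blocks: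
  fixes \<phi> \<psi> :: "(nat \<Rightarrow> real) \<Rightarrow> real"
  assumes "A \<inter> B = {}" "A \<subseteq> {1..}" "B \<subseteq> {1..}"
    and "\<phi> \<in> borel_measurable (PiM A (\<lambda>_. borel))" "\<psi> \<in> borel_measurable (PiM B (\<lambda>_. borel))"
  shows "indep_var borel (\<lambda>\<omega>. \<phi> (\<lambda>i\<in>A. X i \<omega>)) borel (\<lambda>\<omega>. \<psi> (\<lambda>i\<in>B. X i \<omega>))"
  using indep_var_compose[OF indep_var_restrict[OF indep assms(1-3)] assms(4,5)]
  by (simp add: comp_def)

lemma indep_partial_sum_next: "indep_var borel (partial_sum X n) borel (X (Suc n))"
proof -
  have "indep_var borel (\<lambda>\<omega>. (\<lambda>x. \<Sum>i\<in>{1..n}. x i) (\<lambda>i\<in>{1..n}. X i \<omega>))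
    borel (\<lambda>\<omega>. (\<lambda>x. x (Suc n)) (\<lambda>i\<in>{Suc n}. X i \<omega>))"
    by (rule indep_blocks) (auto intro!: borel_measurable_sum)
  then show ?thesis by (simp add: partial_sum_def[abs_def])
qed

lemma expectation_partial_sum_Suc:
  fixes g :: "real \<Rightarrow> real"
  assumes [measurable]: "g \<in> borel_measurable borel" and c: "\<And>x. \<bar>g x\<bar> \<le> c"
  shows "expectation (\<lambda>\<omega>. g (partial_sum X (Suc n) \<omega>)) =
    expectation (\<lambda>\<omega>. \<integral>x. g (partial_sum X n \<omega> + x) \<partial>\<mu>)"
  using indep_var_expectation[OF indep_partial_sum_next, of "\<lambda>(u, v). g (u + v)" c n] c ident[of "Suc n"]
  by (simp add: partial_sum_Suc split_beta)

end

locale density_walk = iid_walk M X for M :: "'a measure" and X +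
  fixes f :: "real \<Rightarrow> real"
  assumes f_meas [measurable]: "f \<in> borel_measurable borel" and f_nonneg: "\<And>x. 0 \<le> f x"
    and law: "distr M borel (X 1) = density lborel (\<lambda>x. ennreal (f x))"
begin

lemma integrable_f: "integrable lborel f" and integral_f: "integral\<^sup>L lborel f = 1"
proof -
  interpret \<mu>: prob_space \<mu> by (rule prob_space_\<mu>)
  have "emeasure \<mu> UNIV = 1" using \<mu>.emeasure_space_1 by simp
  then have "(\<integral>\<^sup>+ x. ennreal (f x) \<partial>lborel) = ennreal 1"
    unfolding law by (subst (asm) emeasure_density) auto
  then have "has_bochner_integral lborel f 1"
    by (intro has_bochner_integral_nn_integral) (auto simp: f_nonneg)
  then show "integrable lborel f" "integral\<^sup>L lborel f = 1"
    by (auto simp: has_bochner_integral_iff)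
qed

text \<open>
Induction on the number of steps.  By the decomposition above, the last step either adds one
averaging factor \<open>(1 + V) / 2\<close>, with weight \<open>p\<close>, or leaves \<open>j\<close> unchanged, with weight \<open>1 - p\<close>.
Keeping \<open>j\<close> arbitrary is what lets the averaging factors accumulate.
\<close>
lemma expectation_avg_diff_bound:
  assumes \<nu> [measurable]: "\<nu> \<in> borel_measurable borel" "integrable lborel \<nu>" and \<nu>0: "\<And>y. 0 \<le> \<nu> y"
    and le: "\<And>y. (\<nu> y + \<nu> (y - d)) / 2 \<le> f y"
    and g: "g \<in> borel_measurable borel" and c: "\<And>x. \<bar>g x\<bar> \<le> c"
  defines "p \<equiv> integral\<^sup>L lborel \<nu>"
  shows "\<bar>expectation (\<lambda>\<omega>. avg_diff j d g (partial_sum X n \<omega>))\<bar> \<le> 2 * c / sqrt (1 + real j + real n * p / 2)"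
  using g c
proof (induction n arbitrary: j g c)
  case 0
  then show ?case
    by (auto intro!: expectation_abs_le avg_diff_bound)
next
  case (Suc n)
  note g[measurable] = Suc.prems(1) and c = Suc.prems(2)
  have c0: "0 \<le> c" using c[of 0] by linarith
  obtain P Q where PQ [measurable]: "P \<in> borel_measurable borel" "Q \<in> borel_measurable borel"
    and PQb: "\<And>x. \<bar>P x\<bar> \<le> p * c" "\<And>x. \<bar>Q x\<bar> \<le> (1 - p) * c"
    and T: "\<And>x. (\<integral>y. g (x + y) * f y \<partial>lborel) = (P x + P (x + d)) / 2 + Q x"
    by (rule kernel_decomposition[OF f_meas integrable_f integral_f \<nu> \<nu>0 le g c, folded p_def])
      (rule that)
  have p0: "0 \<le> p" unfolding p_def by (intro Bochner_Integration.integral_nonneg \<nu>0)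
  have p1: "p \<le> 1"
  proof -
    have "integral\<^sup>L lborel (\<lambda>y. (\<nu> y + \<nu> (y - d)) / 2) \<le> integral\<^sup>L lborel f"
      using \<nu> integrable_f lborel_integrable_real_affine[OF \<nu>(2), of 1 "-d"] le by (intro integral_mono) auto
    also have "integral\<^sup>L lborel (\<lambda>y. (\<nu> y + \<nu> (y - d)) / 2) = p"
      using \<nu> lborel_integrable_real_affine[OF \<nu>(2), of 1 "-d"] lborel_integral_shift[of \<nu> "-d"]
      by (simp add: p_def)
    finally show ?thesis by (simp add: integral_f)
  qed
  note swap = integral_avg_diff[OF integrable_f g c]
  have avg: "avg_diff j d (\<lambda>x. \<integral>y. g (x + y) * f y \<partial>lborel) x = avg_diff (Suc j) d P x + avg_diff j d Q x" for x
    unfolding T avg_diff_add by simp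
  have "expectation (\<lambda>\<omega>. avg_diff j d g (partial_sum X (Suc n) \<omega>)) =
     expectation (\<lambda>\<omega>. \<integral>x. avg_diff j d g (partial_sum X n \<omega> + x) \<partial>\<mu>)"
    by (rule expectation_partial_sum_Suc[of _ "2 * c / sqrt (1 + real j)"]) (auto intro: avg_diff_bound c)
  also have "\<dots> = expectation (\<lambda>\<omega>. \<integral>y. avg_diff j d g (partial_sum X n \<omega> + y) * f y \<partial>lborel)"
    unfolding law by (subst integral_density) (auto simp: f_nonneg mult.commute)
  also have "\<dots> = expectation (\<lambda>\<omega>. avg_diff (Suc j) d P (partial_sum X n \<omega>) + avg_diff j d Q (partial_sum X n \<omega>))"
    unfolding swap avg ..
  also have "\<dots> = expectation (\<lambda>\<omega>. avg_diff (Suc j) d P (partial_sum X n \<omega>)) + expectation (\<lambda>\<omega>. avg_diff j d Q (partial_sum X n \<omega>))"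
    using avg_diff_bound[of P "p * c" "Suc j" d] avg_diff_bound[of Q "(1-p) * c" j d] PQb
    by (intro Bochner_Integration.integral_add integrable_const_bound[of _ "2 * (p * c) / sqrt (1 + real (Suc j))"]
        integrable_const_bound[of _ "2 * ((1 - p) * c) / sqrt (1 + real j)"]) (auto simp del: avg_diff.simps)
  finally have eq: "expectation (\<lambda>\<omega>. avg_diff j d g (partial_sum X (Suc n) \<omega>)) = \<dots>" .
  let ?s = "1 + real j + real n * p / 2"
  have "\<bar>expectation (\<lambda>\<omega>. avg_diff j d g (partial_sum X (Suc n) \<omega>))\<bar> \<le>
      2 * (p * c) / sqrt (1 + real (Suc j) + real n * p / 2) + 2 * ((1 - p) * c) / sqrt ?s"
    unfolding eq by (intro order_trans[OF abs_triangle_ineq] add_mono Suc.IH PQ PQb)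
  also have "\<dots> = 2 * c * (p / sqrt (?s + 1) + (1 - p) / sqrt ?s)"
    by (simp add: algebra_simps add_divide_distrib diff_divide_distrib)
  also have "\<dots> \<le> 2 * c * (1 / sqrt (?s + p / 2))"
    using c0 p0 p1 by (intro mult_left_mono shift_step_ineq) auto
  also have "?s + p / 2 = 1 + real j + real (Suc n) * p / 2" by (simp add: field_simps)
  finally show ?case by simp
qed

text \<open>
A displacement \<open>h\<close> is cut into equal pieces of length at most \<open>d0\<close>, each of which costs
\<open>O (1 / sqrt n)\<close>; the number of pieces is at most \<open>h / d0 + 1\<close>.
\<close>
lemma shift_bound:
  obtains C where "0 < C"
    "\<And>n h (g :: real \<Rightarrow> real) c. \<lbrakk>1 \<le> n; 0 \<le> h; g \<in> borel_measurable borel; \<And>x. \<bar>g x\<bar> \<le> c\<rbrakk> \<Longrightarrow>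
       \<bar>expectation (\<lambda>\<omega>. g (partial_sum X n \<omega> + h)) - expectation (\<lambda>\<omega>. g (partial_sum X n \<omega>))\<bar>
         \<le> c * C * (1 + h) / sqrt (real n)"
proof -
  obtain d0 p where d0: "0 < d0" and p: "0 < p"
    and \<nu>: "\<And>d. 0 < d \<Longrightarrow> d \<le> d0 \<Longrightarrow> \<exists>\<nu>. \<nu> \<in> borel_measurable borel \<and> integrable lborel \<nu> \<and> (\<forall>y. 0 \<le> \<nu> y) \<and>
       (\<forall>y. (\<nu> y + \<nu> (y - d)) / 2 \<le> f y) \<and> p \<le> integral\<^sup>L lborel \<nu>"
    using common_part_of_shifts[OF f_meas f_nonneg integral_f] by metis
  have step: "\<bar>expectation (\<lambda>\<omega>. g (partial_sum X n \<omega> + d)) - expectation (\<lambda>\<omega>. g (partial_sum X n \<omega>))\<bar>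
      \<le> c * (4 / (sqrt p * sqrt (real n)))"
    if n: "1 \<le> n" and d: "0 < d" "d \<le> d0" and [measurable]: "g \<in> borel_measurable borel" and c: "\<And>x. \<bar>g x\<bar> \<le> c"
    for n :: nat and d c :: real and g :: "real \<Rightarrow> real"
  proof -
    have c0: "0 \<le> c" using c[of 0] by linarith
    obtain \<nu> where v: "\<nu> \<in> borel_measurable borel" "integrable lborel \<nu>" "\<And>y. 0 \<le> \<nu> y"
       "\<And>y. (\<nu> y + \<nu> (y - d)) / 2 \<le> f y" "p \<le> integral\<^sup>L lborel \<nu>"
      using \<nu>[OF d] by blast
    have "\<bar>expectation (\<lambda>\<omega>. g (partial_sum X n \<omega> + d)) - expectation (\<lambda>\<omega>. g (partial_sum X n \<omega>))\<bar>
      = \<bar>expectation (\<lambda>\<omega>. avg_diff 0 d g (partial_sum X n \<omega>))\<bar>"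
      using c by (simp, subst Bochner_Integration.integral_diff)
        (auto intro!: integrable_const_bound[of _ c] simp: abs_minus_commute)
    also have "\<dots> \<le> 2 * c / sqrt (1 + real 0 + real n * integral\<^sup>L lborel \<nu> / 2)"
      by (rule expectation_avg_diff_bound[OF v(1-4)]) (use c in auto)
    also have "\<dots> \<le> 2 * c / (sqrt p * sqrt (real n) / 2)"
    proof (intro divide_left_mono)
      have "sqrt p * sqrt (real n) / 2 = sqrt (p * real n / 4)"
        by (simp add: real_sqrt_mult real_sqrt_divide)
      also have "\<dots> \<le> sqrt (1 + real 0 + real n * integral\<^sup>L lborel \<nu> / 2)"
      proof -
        have "real n * p \<le> real n * integral\<^sup>L lborel \<nu>" using v(5) by (intro mult_left_mono) auto
        moreover have "0 \<le> real n * p" using p by simp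
        ultimately show ?thesis by (intro real_sqrt_le_mono) (simp add: mult.commute)
      qed
      finally show "sqrt p * sqrt (real n) / 2 \<le> \<dots>" .
      have "0 \<le> real n * integral\<^sup>L lborel \<nu>" using v(5) p by simp
      then show "0 < sqrt (1 + real 0 + real n * integral\<^sup>L lborel \<nu> / 2) * (sqrt p * sqrt (real n) / 2)"
        using p n by (intro mult_pos_pos) auto
    qed (use c0 in auto)
    finally show ?thesis by (simp add: field_simps)
  qed
  show ?thesis
  proof (rule that[of "4 / sqrt p * (1 / d0 + 1)"])
    show "0 < 4 / sqrt p * (1 / d0 + 1)" using d0 p by (intro mult_pos_pos add_pos_pos) auto
    fix n :: nat and h c :: real and g :: "real \<Rightarrow> real" assume n: "1 \<le> n" and h: "0 \<le> (h::real)" and g[measurable]: "g \<in> borel_measurable borel" and c: "\<And>x. \<bar>g x\<bar> \<le> c"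
    have c0: "0 \<le> c" using c[of 0] by linarith
    (* At least one piece, also for h = 0, so that dividing by N is harmless. *)
    define N where "N = Suc (nat \<lfloor>h / d0\<rfloor>)"
    have N: "h / d0 \<le> real N" "real N \<le> h / d0 + 1" "1 \<le> N"
      using h d0 unfolding N_def by (auto simp: floor_le_iff le_nat_iff) linarith+
    define d where "d = h / real N"
    have d: "0 \<le> d" "d \<le> d0" "real N * d = h"
      using h N d0 by (auto simp: d_def field_simps)
    let ?E = "\<lambda>k. expectation (\<lambda>\<omega>. g (partial_sum X n \<omega> + real k * d))"
    define b where "b = c * (4 / (sqrt p * sqrt (real n)))"
    have b0: "0 \<le> b" unfolding b_def using c0 p by simp
    have one: "\<bar>?E (Suc k) - ?E k\<bar> \<le> b" for k
    proof (cases "d = 0")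
      case True then show ?thesis using b0 by simp
    next
      case False
      then have "0 < d" using d by simp
      from step[OF n this d(2), of "\<lambda>x. g (x + real k * d)" c] c
      show ?thesis by (simp add: algebra_simps b_def)
    qed
    have "\<bar>?E k - ?E 0\<bar> \<le> real k * b" for k
    proof (induction k)
      case (Suc k)
      have "\<bar>?E (Suc k) - ?E 0\<bar> \<le> \<bar>?E (Suc k) - ?E k\<bar> + \<bar>?E k - ?E 0\<bar>" by linarith
      also have "\<dots> \<le> b + real k * b" by (intro add_mono one Suc)
      finally show ?case by (simp add: distrib_right)
    qed simp
    from this[of N] have "\<bar>expectation (\<lambda>\<omega>. g (partial_sum X n \<omega> + h)) - expectation (\<lambda>\<omega>. g (partial_sum X n \<omega>))\<bar> \<le> real N * b"
      using d by simp
    also have "\<dots> \<le> ((1 / d0 + 1) * (1 + h)) * b"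
    proof (intro mult_right_mono b0)
      have "real N \<le> h / d0 + 1" by (rule N)
      also have "\<dots> \<le> (1 / d0 + 1) * (1 + h)" using d0 h by (simp add: field_simps)
      finally show "real N \<le> (1 / d0 + 1) * (1 + h)" .
    qed
    also have "\<dots> = c * (4 / sqrt p * (1 / d0 + 1)) * (1 + h) / sqrt (real n)" by (simp add: b_def)
    finally show "\<bar>expectation (\<lambda>\<omega>. g (partial_sum X n \<omega> + h)) - expectation (\<lambda>\<omega>. g (partial_sum X n \<omega>))\<bar>
         \<le> c * (4 / sqrt p * (1 / d0 + 1)) * (1 + h) / sqrt (real n)" .
  qed
qed

end

section \<open>The half-normal distribution function\<close>

abbreviation \<phi> :: "real \<Rightarrow> real" where "\<phi> \<equiv> std_normal_density"

text \<open>
For \<open>u \<ge> 0\<close> this is the distribution function of the absolute value of a standard normal variable.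
The odd continuation to negative \<open>u\<close> makes \<open>half_normal (y / sqrt s)\<close> a solution of the heat equation
on the whole line that vanishes at \<open>y = 0\<close>.
\<close>
definition half_normal :: "real \<Rightarrow> real" where
  "half_normal u = 2 * cdf std_normal_distribution u - 1"

lemma DERIV_std_normal_density [derivative_intros]:
  "(\<phi> has_real_derivative - u * \<phi> u) (at u)"
proof -
  have "((\<lambda>x. k * exp (- x\<^sup>2 / 2)) has_real_derivative k * (exp (- u\<^sup>2 / 2) * - u)) (at u)" for k
    by (auto intro!: derivative_eq_intros)
  from this[of "1 / sqrt (2 * pi)"] show ?thesis
    by (simp add: std_normal_density_def[abs_def] mult.commute mult.left_commute)
qed

lemma continuous_on_std_normal_density: "continuous_on S \<phi>"
  by (intro continuous_at_imp_continuous_on ballI DERIV_isCont[OF DERIV_std_normal_density])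

lemma DERIV_half_normal: "(half_normal has_real_derivative 2 * \<phi> u) (at u)"
proof -
  interpret N: real_distribution std_normal_distribution by (rule real_dist_normal_dist)
  (* Near u the distribution function is an integral over a compact interval, to which the
     fundamental theorem of calculus applies. *)
  let ?a = "u - 1" and ?b = "u + 1"
  have eq: "cdf std_normal_distribution t = cdf std_normal_distribution ?a + integral {?a..t} \<phi>"
    if "t \<in> {?a<..<?b}" for t
  proof -
    have "cdf std_normal_distribution t - cdf std_normal_distribution ?a = measure std_normal_distribution {?a<..t}"
      using that by (intro N.cdf_diff_eq) auto
    also have "\<dots> = measure std_normal_distribution {?a..t}"
    proof -
      have "emeasure std_normal_distribution {?a<..t} = emeasure std_normal_distribution {?a..t}"
      proof -
        have "AE x in lborel. ennreal (\<phi> x) * indicator {?a<..t} x = ennreal (\<phi> x) * indicator {?a..t} x"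
          using AE_lborel_singleton[of ?a] by eventually_elim (auto split: split_indicator)
        then show ?thesis by (auto simp: emeasure_density intro!: nn_integral_cong_AE)
      qed
      then show ?thesis by (simp add: measure_def)
    qed
    also have "\<dots> = (\<integral>x. \<phi> x * indicator {?a..t} x \<partial>lborel)"
    proof -
      have "measure std_normal_distribution {?a..t} = (\<integral>x. indicator {?a..t} x \<partial>std_normal_distribution)"
        by simp
      also have "\<dots> = (\<integral>x. \<phi> x * indicator {?a..t} x \<partial>lborel)"
        by (subst integral_density) auto
      finally show ?thesis .
    qed
    also have "\<dots> = (LINT x:{?a..t}|lborel. \<phi> x)"
      by (simp add: set_lebesgue_integral_def mult.commute)
    also have "\<dots> = integral {?a..t} \<phi>"
      by (intro set_borel_integral_eq_integral borel_integrable_atLeastAtMost' continuous_on_std_normal_density)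
    finally show ?thesis by simp
  qed
  have "((\<lambda>t. integral {?a..t} \<phi>) has_real_derivative \<phi> u) (at u within {?a..?b})"
    by (intro integral_has_real_derivative continuous_on_std_normal_density) auto
  then have "((\<lambda>t. integral {?a..t} \<phi>) has_real_derivative \<phi> u) (at u)"
    by (simp add: at_within_Icc_at)
  then have "((\<lambda>t. 2 * (cdf std_normal_distribution ?a + integral {?a..t} \<phi>) - 1) has_real_derivative 2 * \<phi> u) (at u)"
    by (auto intro!: derivative_eq_intros)
  then show ?thesis
    by (rule has_field_derivative_transform_within_open[of _ _ _ "{?a<..<?b}"])
      (auto simp: half_normal_def eq)
qed

lemma mono_half_normal: "x \<le> y \<Longrightarrow> half_normal x \<le> half_normal y"
  using finite_borel_measure.cdf_nondecreasing[OF real_distribution.finite_borel_measure_M[OF real_dist_normal_dist], of x y]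
  by (simp add: half_normal_def)

lemma abs_half_normal_le: "\<bar>half_normal x\<bar> \<le> 1"
proof -
  interpret N: real_distribution std_normal_distribution by (rule real_dist_normal_dist)
  show ?thesis using N.cdf_bounded_prob[of x] N.cdf_nonneg[of x] by (simp add: half_normal_def)
qed

lemma half_normal_at_top: "(half_normal \<longlongrightarrow> 1) at_top"
proof -
  interpret N: real_distribution std_normal_distribution by (rule real_dist_normal_dist)
  show ?thesis unfolding half_normal_def by (auto intro!: tendsto_eq_intros N.cdf_lim_at_top_prob)
qed

lemma half_normal_at_bot: "(half_normal \<longlongrightarrow> -1) at_bot"
proof -
  interpret N: real_distribution std_normal_distribution by (rule real_dist_normal_dist)
  show ?thesis unfolding half_normal_def by (auto intro!: tendsto_eq_intros N.cdf_lim_at_bot)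
qed

lemma isCont_half_normal [simp]: "isCont half_normal x"
  using DERIV_half_normal DERIV_isCont by blast

lemma borel_measurable_half_normal [measurable]: "half_normal \<in> borel_measurable borel"
  by (intro borel_measurable_continuous_onI) (auto intro: continuous_at_imp_continuous_on)

text \<open>
The derivative is even, so \<open>half_normal u + half_normal (- u)\<close> is constant; its value is its limit at
infinity.
\<close>
lemma half_normal_minus: "half_normal (- u) = - half_normal u"
proof -
  have \<phi>s: "\<phi> (- t) = \<phi> t" for t by (simp add: std_normal_density_def)
  let ?f = "\<lambda>t. half_normal t + half_normal (- t)"
  have "\<forall>t. (?f has_real_derivative 0) (at t)"
  proof
    fix t
    have "((\<lambda>t. half_normal (- t)) has_real_derivative (2 * \<phi> (- t)) * (-1)) (at t)"
      by (rule DERIV_chain2[OF DERIV_half_normal]) (auto intro!: derivative_eq_intros)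
    from DERIV_add[OF DERIV_half_normal this] show "(?f has_real_derivative 0) (at t)"
      by (simp add: \<phi>s)
  qed
  then have const: "?f t = ?f u" for t by (metis DERIV_isconst_all)
  have "(?f \<longlongrightarrow> 1 + (-1)) at_top"
    by (intro tendsto_add half_normal_at_top filterlim_compose[OF half_normal_at_bot] filterlim_uminus_at_bot_at_top)
  moreover have "?f = (\<lambda>_. ?f u)" by (rule ext, rule const)
  ultimately have "((\<lambda>_. ?f u) \<longlongrightarrow> 0) (at_top :: real filter)" by simp
  then have "?f u = 0" by (simp only: tendsto_const_iff trivial_limit_at_top_linorder not_False_eq_True)
  then show ?thesis by simp
qed

lemma half_normal_0 [simp]: "half_normal 0 = 0"
  using half_normal_minus[of 0] by simp

lemma half_normal_nonneg: "0 \<le> x \<Longrightarrow> 0 \<le> half_normal x"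
  using mono_half_normal[of 0 x] by simp

lemma half_normal_nonpos: "x \<le> 0 \<Longrightarrow> half_normal x \<le> 0"
  using mono_half_normal[of x 0] by simp

lemma std_normal_density_poly_bound:
  shows "(1 + u ^ 4) * \<phi> u \<le> 5"
proof -
  let ?v = "u\<^sup>2 / 2"
  have v: "0 \<le> ?v" by simp
  have "1 + ?v + ?v\<^sup>2 / 2 \<le> exp ?v"
    by (rule exp_lower_Taylor_quadratic) simp
  moreover have "?v\<^sup>2 / 2 = u ^ 4 / 8" by (simp add: power_divide)
  ultimately have e: "1 + u ^ 4 \<le> 9 * exp ?v" using v exp_ge_add_one_self[of ?v] by linarith
  (* The constants 9 and 1/2 are crude bounds for the exponential and for 1 / sqrt (2 pi);
     their product is below 5. *)
  have "sqrt 4 \<le> sqrt (2 * pi)" using pi_gt3 by (intro real_sqrt_le_mono) simp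
  then have "2 \<le> sqrt (2 * pi)" by simp
  then have s: "1 / sqrt (2 * pi) \<le> 1 / 2" by (intro divide_left_mono) auto
  have "(1 + u ^ 4) * \<phi> u = (1 / sqrt (2 * pi)) * ((1 + u ^ 4) * exp (- ?v))"
    by (simp add: std_normal_density_def)
  also have "\<dots> \<le> (1 / 2) * (9 * exp ?v * exp (- ?v))"
    using s e by (intro mult_mono mult_right_mono) auto
  also have "\<dots> \<le> 5" using exp_minus_inverse[of ?v] by (simp add: mult.assoc)
  finally show ?thesis .
qed

lemma std_normal_density_moment_bounds:
  "\<phi> u \<le> 5" "\<bar>u\<bar> * \<phi> u \<le> 5" "u\<^sup>2 * \<phi> u \<le> 5" "\<bar>u\<bar> ^ 3 * \<phi> u \<le> 5"
proof -
  have "a * \<phi> u \<le> 5" if "a \<le> 1 + u ^ 4" for a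
    using mult_right_mono[OF that normal_density_nonneg, of 0 1 u] std_normal_density_poly_bound[of u] by linarith
  note * = this
  have a4: "\<bar>u\<bar> ^ 4 = u ^ 4" by (simp add: power_even_abs)
  have p: "\<bar>u\<bar> ^ k \<le> 1 + u ^ 4" if "k \<le> 4" for k
  proof (cases "\<bar>u\<bar> \<le> 1")
    case True
    then have "\<bar>u\<bar> ^ k \<le> 1" by (intro power_le_one) auto
    then show ?thesis using zero_le_power[of "\<bar>u\<bar>" 4] a4 by linarith
  next
    case False
    then have "\<bar>u\<bar> ^ k \<le> \<bar>u\<bar> ^ 4" using that by (intro power_increasing) auto
    then show ?thesis using a4 by linarith
  qed
  show "\<phi> u \<le> 5" using *[OF p[of 0]] by simp
  show "\<bar>u\<bar> * \<phi> u \<le> 5" using *[OF p[of 1]] by simp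
  show "u\<^sup>2 * \<phi> u \<le> 5" using *[OF p[of 2]] by simp
  show "\<bar>u\<bar> ^ 3 * \<phi> u \<le> 5" using *[OF p[of 3]] by simp
qed

text \<open>
The second- and third-order Taylor remainders, with uniformly bounded derivatives.  The minimum of the
two matters because a step has a finite second moment but perhaps no third moment.
\<close>
lemma half_normal_taylor_space:
  "\<bar>half_normal (u - b) - half_normal u + 2 * b * \<phi> u + b\<^sup>2 * (u * \<phi> u)\<bar> \<le> 10 * min (b\<^sup>2) (\<bar>b\<bar> ^ 3)"
proof (cases "b = 0")
  case True then show ?thesis by simp
next
  case False
  define diff where "diff m = (if m = 0 then half_normal else if m = 1 then (\<lambda>t. 2 * \<phi> t)
     else if m = 2 then (\<lambda>t. - 2 * t * \<phi> t) else (\<lambda>t. 2 * (t\<^sup>2 - 1) * \<phi> t))" for m :: nat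
  have D: "(diff m has_real_derivative diff (Suc m) t) (at t)" if "m < 3" for m t
  proof -
    have "m = 0 \<or> m = 1 \<or> m = 2" using that by auto
    then show ?thesis
      using DERIV_half_normal[of t]
      by (auto simp: diff_def power2_eq_square algebra_simps intro!: derivative_eq_intros)
  qed
  have T: "\<exists>t. half_normal (u - b) = (\<Sum>m<n. (diff m u / fact m) * (- b)^m) + (diff n t / fact n) * (- b)^n"
    if "0 < n" "n \<le> 3" for n
  proof -
    have "\<exists>t. (if u - b < u then u - b < t \<and> t < u else u < t \<and> t < u - b) \<and>
      half_normal (u - b) = (\<Sum>m<n. (diff m u / fact m) * (u - b - u)^m) + (diff n t / fact n) * (u - b - u)^n"
    proof (rule Taylor[of n diff half_normal "u - \<bar>b\<bar>" "u + \<bar>b\<bar>" u "u - b"])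
      show "diff 0 = half_normal" by (simp add: diff_def)
    qed (use D that False in auto)
    then show ?thesis by auto
  qed
  obtain t where t: "half_normal (u - b) = (\<Sum>m<3. (diff m u / fact m) * (- b)^m) + (diff 3 t / fact 3) * (- b)^3"
    using T[of 3] by auto
  obtain s where s: "half_normal (u - b) = (\<Sum>m<2. (diff m u / fact m) * (- b)^m) + (diff 2 s / fact 2) * (- b)^2"
    using T[of 2] by auto
  let ?R = "half_normal (u - b) - half_normal u + 2 * b * \<phi> u + b\<^sup>2 * (u * \<phi> u)"
  have R3: "?R = - (b ^ 3 * ((t\<^sup>2 - 1) * \<phi> t) / 3)"
    unfolding t by (simp add: diff_def eval_nat_numeral field_simps)
  have "0 \<le> \<phi> t" "0 \<le> t\<^sup>2 * \<phi> t" by simp_all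
  with std_normal_density_moment_bounds(1,3)[of t] have "\<bar>t\<^sup>2 * \<phi> t - \<phi> t\<bar> \<le> 10" by linarith
  then have "\<bar>(t\<^sup>2 - 1) * \<phi> t\<bar> \<le> 10" by (simp add: left_diff_distrib)
  then have "\<bar>b\<bar> ^ 3 * \<bar>(t\<^sup>2 - 1) * \<phi> t\<bar> \<le> \<bar>b\<bar> ^ 3 * 10" by (intro mult_left_mono) auto
  then have "\<bar>b\<bar> ^ 3 * \<bar>(t\<^sup>2 - 1) * \<phi> t\<bar> \<le> 30 * \<bar>b\<bar> ^ 3"
    using zero_le_power[OF abs_ge_zero, of b 3] by linarith
  then have r3: "\<bar>?R\<bar> \<le> 10 * \<bar>b\<bar> ^ 3"
    unfolding R3 by (simp add: abs_mult power_abs)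
  have R2: "?R = b\<^sup>2 * (u * \<phi> u - s * \<phi> s)"
    unfolding s by (simp add: diff_def eval_nat_numeral algebra_simps)
  have "\<bar>u * \<phi> u - s * \<phi> s\<bar> \<le> \<bar>u * \<phi> u\<bar> + \<bar>s * \<phi> s\<bar>" by (rule abs_triangle_ineq4)
  also have "\<dots> \<le> 10" using std_normal_density_moment_bounds(2)[of u] std_normal_density_moment_bounds(2)[of s]
    by (simp add: abs_mult)
  finally have "b\<^sup>2 * \<bar>u * \<phi> u - s * \<phi> s\<bar> \<le> b\<^sup>2 * 10" by (intro mult_left_mono) auto
  then have r2: "\<bar>?R\<bar> \<le> 10 * b\<^sup>2"
    unfolding R2 by (simp add: abs_mult)
  show ?thesis using r2 r3 by (auto simp: min_def)
qed

text \<open>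
First-order expansion of \<open>half_normal (u / sqrt (1 + \<theta>))\<close> in \<open>\<theta>\<close>.  Its linear term \<open>- \<theta> u \<phi> u\<close> equals the
one that a centred displacement of variance \<open>\<theta>\<close> produces in \<open>half_normal_taylor_space\<close>; this is the
heat equation.
\<close>
lemma half_normal_taylor_time:
  assumes "0 \<le> \<theta>"
  shows "\<bar>half_normal (u / sqrt (1 + \<theta>)) - half_normal u + \<theta> * (u * \<phi> u)\<bar> \<le> 10 * \<theta>\<^sup>2"
proof (cases "\<theta> = 0")
  case True then show ?thesis by simp
next
  case False
  with assms have \<theta>: "0 < \<theta>" by simp
  define w where "w t = u / sqrt (1 + t)" for t
  (* The first two derivatives of half_normal (w t), by w' = - w / (2 (1 + t)). *)
  define diff where "diff m = (if m = 0 then (\<lambda>t. half_normal (w t)) else if m = 1 then (\<lambda>t. - (w t * \<phi> (w t)) / (1 + t))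
     else (\<lambda>t. (3 / 2 * w t - (w t) ^ 3 / 2) * \<phi> (w t) / (1 + t)\<^sup>2))" for m :: nat
  have dw: "(w has_real_derivative - w t / (2 * (1 + t))) (at t)" if "0 \<le> t" for t
    unfolding w_def using that
    by (auto intro!: derivative_eq_intros simp: field_simps)
  have D: "(diff m has_real_derivative diff (Suc m) t) (at t)" if "m < 2" "0 \<le> t" for m t
  proof -
    have m: "m = 0 \<or> m = 1" using that by auto
    have d\<phi>: "((\<lambda>t. \<phi> (w t)) has_real_derivative (- w t * \<phi> (w t)) * (- w t / (2 * (1 + t)))) (at t)"
      by (rule DERIV_chain2[OF DERIV_std_normal_density dw[OF that(2)]])
    have "2 * P * (- W / (2 * r)) = - (W * P) / r" for W P r :: real by simp
    then have "((\<lambda>t. half_normal (w t)) has_real_derivative - (w t * \<phi> (w t)) / (1 + t)) (at t)"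
      using DERIV_chain2[OF DERIV_half_normal dw[OF that(2)]] by (metis (no_types))
    moreover have "((\<lambda>t. - (w t * \<phi> (w t)) / (1 + t)) has_real_derivative
       (3 / 2 * w t - (w t) ^ 3 / 2) * \<phi> (w t) / (1 + t)\<^sup>2) (at t)"
    proof -
      have num: "((\<lambda>t. - (w t * \<phi> (w t))) has_real_derivative
          - ((- w t / (2 * (1 + t))) * \<phi> (w t) + ((- w t * \<phi> (w t)) * (- w t / (2 * (1 + t)))) * w t)) (at t)"
        by (intro DERIV_minus DERIV_mult dw d\<phi> that(2))
      have den: "((\<lambda>t. 1 + t) has_real_derivative 1) (at t)"
        by (auto intro!: derivative_eq_intros)
      have "(- ((- W / (2 * r)) * P + ((- W * P) * (- W / (2 * r))) * W) * r - - (W * P) * 1) / (r * r) =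
          (3 / 2 * W - W ^ 3 / 2) * P / r\<^sup>2" if "r \<noteq> 0" for W P r :: real
        using that by (simp add: field_simps power2_eq_square power3_eq_cube)
      from this[of "1 + t" "w t" "\<phi> (w t)"] show ?thesis
        using DERIV_divide[OF num den] that(2) by (auto elim!: DERIV_cong)
    qed
    ultimately show ?thesis
      using m by (auto simp: diff_def)
  qed
  have "\<exists>t. (if \<theta> < 0 then \<theta> < t \<and> t < 0 else 0 < t \<and> t < \<theta>) \<and>
     half_normal (w \<theta>) = (\<Sum>m<2. (diff m 0 / fact m) * (\<theta> - 0)^m) + (diff 2 t / fact 2) * (\<theta> - 0)^2"
    by (rule Taylor[of 2 diff "\<lambda>t. half_normal (w t)" 0 \<theta> 0 \<theta>]) (use D \<theta> in \<open>auto simp: diff_def\<close>)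
  then obtain t where t: "0 < t"
    "half_normal (w \<theta>) = (\<Sum>m<2. (diff m 0 / fact m) * \<theta>^m) + (diff 2 t / fact 2) * \<theta>^2"
    using \<theta> by auto
  have R: "half_normal (u / sqrt (1 + \<theta>)) - half_normal u + \<theta> * (u * \<phi> u) =
     ((3 / 2 * w t - (w t) ^ 3 / 2) * \<phi> (w t) / (1 + t)\<^sup>2) / 2 * \<theta>\<^sup>2"
    unfolding w_def[symmetric] t(2) by (simp add: diff_def eval_nat_numeral w_def)
  have "\<bar>(3 / 2 * w t - (w t) ^ 3 / 2) * \<phi> (w t)\<bar> \<le> 3 / 2 * (\<bar>w t\<bar> * \<phi> (w t)) + (\<bar>w t\<bar> ^ 3 * \<phi> (w t)) / 2"
    unfolding left_diff_distrib
    by (rule order_trans[OF abs_triangle_ineq4]) (simp add: abs_mult power_abs)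
  also have "\<dots> \<le> 10" using std_normal_density_moment_bounds(2,4)[of "w t"] by linarith
  finally have "\<bar>(3 / 2 * w t - (w t) ^ 3 / 2) * \<phi> (w t)\<bar> / (1 + t)\<^sup>2 \<le> 10 / 1"
    using t(1) by (intro frac_le) (auto simp: one_le_power)
  then have "\<bar>(3 / 2 * w t - (w t) ^ 3 / 2) * \<phi> (w t) / (1 + t)\<^sup>2\<bar> / 2 * \<theta>\<^sup>2 \<le> 10 * \<theta>\<^sup>2"
    by (intro mult_right_mono) (auto simp: abs_divide)
  then show ?thesis unfolding R by (simp add: abs_mult abs_divide)
qed

section \<open>Comparing the recursion of the maximum with the heat equation\<close>

locale standardized_law = real_distribution \<mu> for \<mu> :: "real measure" +
  assumes integrable_square: "integrable \<mu> (\<lambda>x. x\<^sup>2)"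
    and mean: "(\<integral>x. x \<partial>\<mu>) = 0" and second_moment: "(\<integral>x. x\<^sup>2 \<partial>\<mu>) = 1"
begin

lemma integrable_id: "integrable \<mu> (\<lambda>x. x)"
proof (rule Bochner_Integration.integrable_bound[where f="\<lambda>x. 1 + x\<^sup>2"])
  show "AE x in \<mu>. norm x \<le> norm (1 + x\<^sup>2 :: real)"
  proof (rule AE_I2)
    fix x :: real
    have "0 \<le> (\<bar>x\<bar> - 1)\<^sup>2" by simp
    then have "2 * \<bar>x\<bar> \<le> 1 + x\<^sup>2" by (simp add: power2_diff)
    then show "norm x \<le> norm (1 + x\<^sup>2)" by simp
  qed
qed (auto intro!: integrable_square)

text \<open>
This is \<open>a\<close> times the average of the remainder bound \<open>min (b\<^sup>2) (\<bar>b\<bar> ^ 3)\<close> at the displacement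
\<open>b = x / sqrt a\<close>.  It tends to \<open>0\<close> by dominated convergence, which plays the part of Lindeberg's
condition.
\<close>
definition trunc_moment :: "real \<Rightarrow> real" where
  "trunc_moment a = (\<integral>x. min (x\<^sup>2) (\<bar>x\<bar> ^ 3 / sqrt a) \<partial>\<mu>)"

lemma abs_trunc_le: "0 \<le> a \<Longrightarrow> \<bar>min (x\<^sup>2) (\<bar>x\<bar> ^ 3 / sqrt a)\<bar> \<le> x\<^sup>2" for x :: real
  by (subst abs_of_nonneg) auto

lemma integrable_trunc: "0 \<le> a \<Longrightarrow> integrable \<mu> (\<lambda>x. min (x\<^sup>2) (\<bar>x\<bar> ^ 3 / sqrt a))"
  by (rule Bochner_Integration.integrable_bound[OF integrable_square])
    (use abs_trunc_le in auto)

lemma trunc_moment_tendsto_0: "(trunc_moment \<longlongrightarrow> 0) at_top"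
proof -
  have "((\<lambda>a. \<integral>x. min (x\<^sup>2) (\<bar>x\<bar> ^ 3 / sqrt a) \<partial>\<mu>) \<longlongrightarrow> (\<integral>x. 0 \<partial>\<mu>)) at_top"
  proof (rule integral_dominated_convergence_at_top[where w="\<lambda>x. x\<^sup>2"])
    show "\<forall>\<^sub>F a in at_top. AE x in \<mu>. norm (min (x\<^sup>2) (\<bar>x\<bar> ^ 3 / sqrt a)) \<le> x\<^sup>2"
      using eventually_ge_at_top[of "0::real"] by eventually_elim (use abs_trunc_le in auto)
    show "AE x in \<mu>. ((\<lambda>a. min (x\<^sup>2) (\<bar>x\<bar> ^ 3 / sqrt a)) \<longlongrightarrow> 0) at_top"
    proof (rule AE_I2)
      fix x :: real
      have lim: "((\<lambda>a. \<bar>x\<bar> ^ 3 / sqrt a) \<longlongrightarrow> 0) at_top"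
        by (intro real_tendsto_divide_at_top[OF tendsto_const] sqrt_at_top)
      show "((\<lambda>a. min (x\<^sup>2) (\<bar>x\<bar> ^ 3 / sqrt a)) \<longlongrightarrow> 0) at_top"
        using tendsto_min[OF tendsto_const[of "x\<^sup>2"] lim] by simp
    qed
  qed (auto intro!: integrable_square)
  then show ?thesis by (simp add: trunc_moment_def[abs_def])
qed

lemma trunc_moment_nonneg: "0 \<le> a \<Longrightarrow> 0 \<le> trunc_moment a"
  unfolding trunc_moment_def by (intro Bochner_Integration.integral_nonneg) auto

definition step_error :: "real \<Rightarrow> real" where
  "step_error a = 10 * (trunc_moment a + 1 / a)"

lemma step_error_tendsto_0: "(step_error \<longlongrightarrow> 0) at_top"
proof -
  have "((\<lambda>a. 10 * (trunc_moment a + 1 / a)) \<longlongrightarrow> 10 * (0 + 0)) at_top"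
    by (intro tendsto_intros trunc_moment_tendsto_0 real_tendsto_divide_at_top[OF tendsto_const] filterlim_ident)
  then show ?thesis by (simp add: step_error_def[abs_def])
qed

text \<open>
In the spatial expansion at \<open>y / sqrt s\<close> the linear term averages to \<open>0\<close> and the quadratic one to
\<open>1 / s\<close> times its coefficient, which is exactly the linear term of the expansion in time from \<open>s\<close> to
\<open>s + 1\<close>.  Only the two remainders are left.
\<close>
lemma heat_step:
  assumes a: "0 < a" "a \<le> s"
  shows "\<bar>(\<integral>x. half_normal ((y - x) / sqrt s) \<partial>\<mu>) - half_normal (y / sqrt (s + 1))\<bar> \<le> step_error a / a"
proof -
  have s: "0 < s" using a by linarith
  define u where "u = y / sqrt s"
  let ?b = "\<lambda>x. x / sqrt s"
  (* The remainder of the spatial expansion, as a function of the step x. *)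
  let ?R = "\<lambda>x. half_normal (u - ?b x) - half_normal u + 2 * ?b x * \<phi> u + (?b x)\<^sup>2 * (u * \<phi> u)"
  have sq: "(sqrt s)\<^sup>2 = s" using s by simp
  have int: "integrable \<mu> (\<lambda>x. half_normal (u - ?b x))"
    by (rule integrable_const_bound[of _ 1]) (auto simp: abs_half_normal_le)
  have b2: "(?b x)\<^sup>2 = x\<^sup>2 / s" for x by (simp add: power_divide sq)
  have intR: "integrable \<mu> ?R"
    unfolding b2 using int integrable_id integrable_square by simp
  have "(\<integral>x. ?R x \<partial>\<mu>) = (\<integral>x. half_normal (u - ?b x) \<partial>\<mu>) - half_normal u + 1 / s * (u * \<phi> u)"
    unfolding b2 using int integrable_id integrable_square mean second_moment prob_space
    by simp
  moreover have "\<bar>\<integral>x. ?R x \<partial>\<mu>\<bar> \<le> 10 * (trunc_moment a / a)"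
  proof -
    have bound: "\<bar>?R x\<bar> \<le> 10 * (min (x\<^sup>2) (\<bar>x\<bar> ^ 3 / sqrt a) / a)" for x
    proof -
      have 1: "x\<^sup>2 / s \<le> x\<^sup>2 / a" using a by (intro divide_left_mono) auto
      have "sqrt a * a \<le> sqrt s * s" using a by (intro mult_mono) auto
      then have "\<bar>x\<bar> ^ 3 / (sqrt s * s) \<le> \<bar>x\<bar> ^ 3 / (sqrt a * a)"
        using a s by (intro divide_left_mono) auto
      moreover have "\<bar>?b x\<bar> ^ 3 = \<bar>x\<bar> ^ 3 / (sqrt s * s)"
        using s sq by (simp add: abs_divide power_divide power3_eq_cube power2_eq_square)
      ultimately have 2: "\<bar>?b x\<bar> ^ 3 \<le> \<bar>x\<bar> ^ 3 / sqrt a / a" by simp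
      have "min ((?b x)\<^sup>2) (\<bar>?b x\<bar> ^ 3) \<le> min (x\<^sup>2 / a) (\<bar>x\<bar> ^ 3 / sqrt a / a)"
        using 1 2 unfolding b2 by (intro min.mono)
      also have "\<dots> = min (x\<^sup>2) (\<bar>x\<bar> ^ 3 / sqrt a) / a"
        using a by (simp add: min_divide_distrib_right)
      finally show ?thesis using half_normal_taylor_space[of u "?b x"] by linarith
    qed
    have "\<bar>\<integral>x. ?R x \<partial>\<mu>\<bar> \<le> (\<integral>x. \<bar>?R x\<bar> \<partial>\<mu>)" by (rule integral_abs_bound)
    also have "\<dots> \<le> (\<integral>x. 10 * (min (x\<^sup>2) (\<bar>x\<bar> ^ 3 / sqrt a) / a) \<partial>\<mu>)"
    proof (rule integral_mono)
      show "integrable \<mu> (\<lambda>x. \<bar>?R x\<bar>)" using intR by (rule integrable_abs)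
      show "integrable \<mu> (\<lambda>x. 10 * (min (x\<^sup>2) (\<bar>x\<bar> ^ 3 / sqrt a) / a))"
        using integrable_trunc[of a] a by simp
      show "\<bar>?R x\<bar> \<le> 10 * (min (x\<^sup>2) (\<bar>x\<bar> ^ 3 / sqrt a) / a)" for x by (rule bound)
    qed
    also have "\<dots> = 10 * (trunc_moment a / a)"
      by (simp add: trunc_moment_def)
    finally show ?thesis .
  qed
  moreover have "\<bar>half_normal (u / sqrt (1 + 1 / s)) - half_normal u + 1 / s * (u * \<phi> u)\<bar> \<le> 10 * (1 / s)\<^sup>2"
    using s by (intro half_normal_taylor_time) auto
  moreover have "u / sqrt (1 + 1 / s) = y / sqrt (s + 1)"
  proof -
    have "sqrt s * sqrt (1 + 1 / s) = sqrt (s + 1)"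
      unfolding real_sqrt_mult[symmetric] using s by (simp add: field_simps)
    then show ?thesis by (simp add: u_def)
  qed
  moreover have "(1 / s)\<^sup>2 \<le> 1 / a / a"
    using a by (simp add: power2_eq_square frac_le mult_mono)
  moreover have "half_normal ((y - x) / sqrt s) = half_normal (u - ?b x)" for x
    by (simp add: u_def diff_divide_distrib)
  moreover have "step_error a / a = 10 * (trunc_moment a / a) + 10 * (1 / a / a)"
    by (simp add: step_error_def add_divide_distrib)
  ultimately show ?thesis by simp
qed

text \<open>
Here \<open>half_normal (y / sqrt (a + j))\<close> is, up to the accumulated errors, a subsolution: it is at most \<open>1\<close>
initially, and it is nonpositive for \<open>y < 0\<close>, where \<open>v j\<close> vanishes, so replacing it by \<open>0\<close> there only
increases the average.
\<close>
lemma max_cdf_lower: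
  fixes v :: "nat \<Rightarrow> real \<Rightarrow> real"
  assumes v [measurable]: "\<And>j. v j \<in> borel_measurable borel" and v01: "\<And>j y. 0 \<le> v j y \<and> v j y \<le> 1"
    and v0: "\<And>y. 0 \<le> y \<Longrightarrow> v 0 y = 1"
    and vSuc: "\<And>j y. 0 \<le> y \<Longrightarrow> v (Suc j) y = (\<integral>x. v j (y - x) \<partial>\<mu>)"
    and a: "0 < a"
  shows "half_normal (y / sqrt (a + real j)) - real j * (step_error a / a) \<le> v j y"
proof -
  have e0: "0 \<le> step_error a / a"
    using trunc_moment_nonneg[of a] a by (simp add: step_error_def)
  show ?thesis
  proof (induction j arbitrary: y)
    case 0
    show ?case
    proof (cases "0 \<le> y")
      case True
      then show ?thesis using abs_half_normal_le[of "y / sqrt a"] v0[of y] by simp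
    next
      case False
      then have "y / sqrt a \<le> 0" using a by (simp add: divide_nonpos_pos)
      then show ?thesis using half_normal_nonpos[of "y / sqrt a"] v01[of 0 y] by simp
    qed
  next
    case (Suc j)
    show ?case
    proof (cases "0 \<le> y")
      case True
      have inth: "integrable \<mu> (\<lambda>x. half_normal ((y - x) / sqrt (a + real j)))"
        by (rule integrable_const_bound[of _ 1]) (auto simp: abs_half_normal_le)
      have intv: "integrable \<mu> (\<lambda>x. v j (y - x))"
        by (rule integrable_const_bound[of _ 1]) (auto simp: v01)
      have "half_normal (y / sqrt (a + real (Suc j))) - real (Suc j) * (step_error a / a)
        \<le> (\<integral>x. half_normal ((y - x) / sqrt (a + real j)) \<partial>\<mu>) - real j * (step_error a / a)"
        using heat_step[of a "a + real j" y] a by (simp add: algebra_simps add_divide_distrib)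
      also have "\<dots> = (\<integral>x. half_normal ((y - x) / sqrt (a + real j)) - real j * (step_error a / a) \<partial>\<mu>)"
        using inth prob_space by simp
      also have "\<dots> \<le> (\<integral>x. v j (y - x) \<partial>\<mu>)"
        using inth intv Suc by (intro integral_mono) auto
      finally show ?thesis using vSuc[OF True] by simp
    next
      case False
      then have "y / sqrt (a + real (Suc j)) \<le> 0" using a by (intro divide_nonpos_pos) auto
      then have "half_normal (y / sqrt (a + real (Suc j))) \<le> 0" by (rule half_normal_nonpos)
      moreover have "0 \<le> real (Suc j) * (step_error a / a)" by (intro mult_nonneg_nonneg e0) auto
      ultimately show ?thesis using v01[of "Suc j" y] by linarith
    qed
  qed
qed

text \<open>
Moving the boundary from \<open>0\<close> to \<open>- D\<close> and adding \<open>1 - half_normal (D / sqrt a)\<close> gives a supersolution: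
it is at least \<open>1\<close> initially on \<open>y \<ge> 0\<close> and nonnegative on \<open>y \<ge> - D\<close>.  It can fail to dominate only
after a jump from \<open>y \<ge> 0\<close> to below \<open>- D\<close>, that is, after a step larger than \<open>D\<close>; the term
\<open>measure \<mu> {D<..}\<close> pays for that.
\<close>
lemma max_cdf_upper:
  fixes v :: "nat \<Rightarrow> real \<Rightarrow> real"
  assumes v [measurable]: "\<And>j. v j \<in> borel_measurable borel" and v01: "\<And>j y. 0 \<le> v j y \<and> v j y \<le> 1"
    and vneg: "\<And>j y. y < 0 \<Longrightarrow> v j y = 0"
    and vSuc: "\<And>j y. 0 \<le> y \<Longrightarrow> v (Suc j) y = (\<integral>x. v j (y - x) \<partial>\<mu>)"
    and a: "0 < a" and D: "0 \<le> D" and y: "- D \<le> y"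
  shows "v j y \<le> half_normal ((y + D) / sqrt (a + real j)) + (1 - half_normal (D / sqrt a))
     + real j * (step_error a / a + measure \<mu> {D<..})"
proof -
  let ?\<eta> = "1 - half_normal (D / sqrt a)" and ?\<kappa> = "step_error a / a + measure \<mu> {D<..}"
  have e0: "0 \<le> step_error a / a"
    using trunc_moment_nonneg[of a] a by (simp add: step_error_def)
  have \<kappa>: "0 \<le> ?\<kappa>" using e0 by simp
  have \<eta>: "0 \<le> ?\<eta>" using abs_half_normal_le[of "D / sqrt a"] by simp
  show ?thesis using y
  proof (induction j arbitrary: y)
    case 0
    show ?case
    proof (cases "0 \<le> y")
      case True
      then have "D / sqrt a \<le> (y + D) / sqrt a" using a by (intro divide_right_mono) auto
      from mono_half_normal[OF this] show ?thesis using v01[of 0 y] by simp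
    next
      case False
      have "0 \<le> (y + D) / sqrt a" using 0 a by simp
      from half_normal_nonneg[OF this] show ?thesis using False \<eta> vneg[of y 0] by simp
    qed
  next
    case (Suc j)
    have \<kappa>': "0 \<le> real k * ?\<kappa>" for k by (intro mult_nonneg_nonneg \<kappa>) simp
    show ?case
    proof (cases "0 \<le> y")
      case True
      let ?h = "\<lambda>x. half_normal ((y - x + D) / sqrt (a + real j))"
      have inth: "integrable \<mu> ?h"
        by (rule integrable_const_bound[of _ 1]) (auto simp: abs_half_normal_le)
      have intv: "integrable \<mu> (\<lambda>x. v j (y - x))"
        by (rule integrable_const_bound[of _ 1]) (auto simp: v01)
      have inti: "integrable \<mu> (indicator {D<..} :: real \<Rightarrow> real)"
        by (rule integrable_const_bound[of _ 1]) auto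
      have "v (Suc j) y = (\<integral>x. v j (y - x) \<partial>\<mu>)" by (rule vSuc[OF True])
      also have "\<dots> \<le> (\<integral>x. ?h x + (?\<eta> + real j * ?\<kappa>) + indicator {D<..} x \<partial>\<mu>)"
      proof (rule integral_mono)
        fix x
        show "v j (y - x) \<le> ?h x + (?\<eta> + real j * ?\<kappa>) + indicator {D<..} x"
        proof (cases "- D \<le> y - x")
          case True
          have "0 \<le> (indicator {D<..} x :: real)" by simp
          then show ?thesis using Suc.IH[OF True] by linarith
        next
          case False
          then have "x \<in> {D<..}" "y - x < 0" using True D by auto
          then show ?thesis
            using vneg[of "y - x" j] \<eta> \<kappa>'[of j] abs_half_normal_le[of "(y - x + D) / sqrt (a + real j)"]
            by (simp add: abs_le_iff)
        qed
      qed (use inth intv inti in auto)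
      also have "\<dots> = (\<integral>x. half_normal ((y + D - x) / sqrt (a + real j)) \<partial>\<mu>) + (?\<eta> + real j * ?\<kappa>) + measure \<mu> {D<..}"
        using inth inti prob_space by (simp add: algebra_simps)
      also have "\<dots> \<le> half_normal ((y + D) / sqrt (a + real (Suc j))) + step_error a / a + (?\<eta> + real j * ?\<kappa>) + measure \<mu> {D<..}"
        using heat_step[of a "a + real j" "y + D"] a by (simp add: algebra_simps)
      finally show ?thesis by (simp add: algebra_simps add_divide_distrib)
    next
      case False
      have "0 \<le> (y + D) / sqrt (a + real (Suc j))" using Suc.prems a by simp
      from half_normal_nonneg[OF this] show ?thesis
        using False \<eta> \<kappa>'[of "Suc j"] vneg[of y "Suc j"] by linarith
    qed
  qed
qed

text \<open>
Chebyshev's inequality for the truncated moment.  Unlike the ordinary second moment it yields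
\<open>o (1 / a)\<close> for the probability of a step larger than \<open>\<delta> sqrt a\<close>.
\<close>
lemma tail_bound:
  assumes a: "0 < a" and \<delta>: "0 < \<delta>"
  shows "a * measure \<mu> {\<delta> * sqrt a<..} \<le> trunc_moment a / min (\<delta>\<^sup>2) (\<delta> ^ 3)"
proof -
  let ?m = "min (\<delta>\<^sup>2) (\<delta> ^ 3)" and ?A = "{\<delta> * sqrt a<..}"
  have m: "0 < ?m" using \<delta> by simp
  have "a * ?m * indicator ?A x \<le> min (x\<^sup>2) (\<bar>x\<bar> ^ 3 / sqrt a)" for x
  proof (cases "x \<in> ?A")
    case True
    then have x: "\<delta> * sqrt a \<le> x" by simp
    have p: "0 \<le> \<delta> * sqrt a" using \<delta> a by simp
    have "(\<delta> * sqrt a)\<^sup>2 \<le> x\<^sup>2" using x p by (intro power_mono)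
    then have 1: "a * \<delta>\<^sup>2 \<le> x\<^sup>2" using a by (simp add: power_mult_distrib mult.commute)
    have "(\<delta> * sqrt a) ^ 3 \<le> \<bar>x\<bar> ^ 3" using x p by (intro power_mono) auto
    moreover have "(\<delta> * sqrt a) ^ 3 = a * \<delta> ^ 3 * sqrt a"
      using a by (simp add: power_mult_distrib power3_eq_cube)
    ultimately have 2: "a * \<delta> ^ 3 \<le> \<bar>x\<bar> ^ 3 / sqrt a" using a by (simp add: pos_le_divide_eq)
    have "a * ?m \<le> a * \<delta>\<^sup>2" "a * ?m \<le> a * \<delta> ^ 3" using a by (auto intro!: mult_left_mono)
    then show ?thesis using 1 2 True by simp
  next
    case False
    then show ?thesis using a by simp
  qed
  then have "(\<integral>x. a * ?m * indicator ?A x \<partial>\<mu>) \<le> trunc_moment a"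
    unfolding trunc_moment_def
  proof (intro integral_mono)
    show "integrable \<mu> (\<lambda>x. a * ?m * indicator ?A x)"
      by (intro integrable_mult_right integrable_const_bound[of _ 1]) auto
    show "integrable \<mu> (\<lambda>x. min (x\<^sup>2) (\<bar>x\<bar> ^ 3 / sqrt a))" using a by (intro integrable_trunc) simp
  qed
  then have "a * ?m * measure \<mu> ?A \<le> trunc_moment a" by simp
  then show ?thesis using m by (simp only: pos_le_divide_eq mult.commute mult.left_commute)
qed

text \<open>
Both comparison bounds are used with \<open>a = \<epsilon> n\<close> and \<open>D = \<delta> sqrt n\<close>.  The parameters are chosen in the
order \<open>\<delta>\<close>, \<open>\<epsilon>\<close>, \<open>n\<close>, since the initial error \<open>1 - half_normal (\<delta> / sqrt \<epsilon>)\<close> is small only if \<open>\<epsilon>\<close> is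
small compared to \<open>\<delta>\<^sup>2\<close>.
\<close>
theorem max_cdf_limit:
  fixes v :: "nat \<Rightarrow> real \<Rightarrow> real"
  assumes v: "\<And>j. v j \<in> borel_measurable borel" and v01: "\<And>j y. 0 \<le> v j y \<and> v j y \<le> 1"
    and v0: "\<And>y. 0 \<le> y \<Longrightarrow> v 0 y = 1" and vneg: "\<And>j y. y < 0 \<Longrightarrow> v j y = 0"
    and vSuc: "\<And>j y. 0 \<le> y \<Longrightarrow> v (Suc j) y = (\<integral>x. v j (y - x) \<partial>\<mu>)"
    and x: "0 \<le> x"
  shows "(\<lambda>n. v n (x * sqrt (real n))) \<longlonglongrightarrow> half_normal x"
proof (rule tendstoI)
  fix e :: real assume e: "0 < e"
  have "((\<lambda>\<delta>. half_normal (x + \<delta>)) \<longlongrightarrow> half_normal (x + 0)) (at_right 0)"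
    by (intro isCont_tendsto_compose[OF isCont_half_normal] tendsto_intros)
  then have "\<forall>\<^sub>F \<delta> in at_right 0. half_normal (x + \<delta>) < half_normal x + e / 4"
    using e by (intro order_tendstoD) auto
  with eventually_at_right_less[of "0::real"] have "\<forall>\<^sub>F \<delta> in at_right 0. 0 < \<delta> \<and> half_normal (x + \<delta>) < half_normal x + e / 4"
    by eventually_elim simp
  then obtain \<delta> where \<delta>: "0 < \<delta>" "half_normal (x + \<delta>) < half_normal x + e / 4"
    using eventually_happens trivial_limit_at_right_real by (metis (no_types, lifting))
  have "((\<lambda>\<epsilon>. half_normal (x / sqrt (\<epsilon> + 1))) \<longlongrightarrow> half_normal (x / sqrt (0 + 1))) (at_right 0)"
    by (intro isCont_tendsto_compose[OF isCont_half_normal] tendsto_intros) auto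
  then have 1: "\<forall>\<^sub>F \<epsilon> in at_right 0. half_normal x - e / 4 < half_normal (x / sqrt (\<epsilon> + 1))"
    using e by (intro order_tendstoD) auto
  have "filterlim (\<lambda>\<epsilon>. \<delta> / sqrt \<epsilon>) at_top (at_right 0)"
  proof -
    have "filterlim sqrt (at_right 0) (at_right 0)"
      unfolding filterlim_at using eventually_at_right_less[of "0::real"]
      by (auto intro!: tendsto_eq_intros elim!: eventually_mono)
    from filterlim_compose[OF filterlim_inverse_at_top_right this]
    have "filterlim (\<lambda>\<epsilon>. \<delta> * inverse (sqrt \<epsilon>)) at_top (at_right 0)"
      using \<delta>(1) by (intro filterlim_tendsto_pos_mult_at_top[OF tendsto_const])
    then show ?thesis by (simp add: divide_inverse)
  qed
  from filterlim_compose[OF half_normal_at_top this]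
  have 2: "\<forall>\<^sub>F \<epsilon> in at_right 0. 1 - e / 4 < half_normal (\<delta> / sqrt \<epsilon>)"
    using e by (intro order_tendstoD) auto
  have "\<forall>\<^sub>F \<epsilon> in at_right 0. 0 < \<epsilon> \<and> half_normal x - e / 4 < half_normal (x / sqrt (\<epsilon> + 1))
      \<and> 1 - e / 4 < half_normal (\<delta> / sqrt \<epsilon>)"
    using 1 2 eventually_at_right_less[of "0::real"] by eventually_elim simp
  then obtain \<epsilon> where \<epsilon>: "0 < \<epsilon>" "half_normal x - e / 4 < half_normal (x / sqrt (\<epsilon> + 1))"
      "1 - e / 4 < half_normal (\<delta> / sqrt \<epsilon>)"
    using eventually_happens trivial_limit_at_right_real by (metis (no_types, lifting))
  define m where "m = min (\<delta>\<^sup>2) (\<delta> ^ 3)"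
  have real_n: "filterlim (\<lambda>n::nat. \<epsilon> * real n) at_top sequentially"
    using \<epsilon>(1) by (intro filterlim_tendsto_pos_mult_at_top[OF tendsto_const] filterlim_real_sequentially)
  have "(\<lambda>n. step_error (\<epsilon> * real n) / \<epsilon>) \<longlonglongrightarrow> 0 / \<epsilon>"
    using \<epsilon> by (intro tendsto_intros filterlim_compose[OF step_error_tendsto_0 real_n]) auto
  then have 3: "\<forall>\<^sub>F n in sequentially. step_error (\<epsilon> * real n) / \<epsilon> < e / 4"
    using e by (intro order_tendstoD) auto
  have "(\<lambda>n. trunc_moment (real n) / m) \<longlonglongrightarrow> 0 / m"
    using \<delta> by (intro tendsto_intros filterlim_compose[OF trunc_moment_tendsto_0 filterlim_real_sequentially]) (auto simp: m_def min_def)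
  then have 4: "\<forall>\<^sub>F n in sequentially. trunc_moment (real n) / m < e / 4"
    using e by (intro order_tendstoD) auto
  show "\<forall>\<^sub>F n in sequentially. dist (v n (x * sqrt (real n))) (half_normal x) < e"
    using 3 4 eventually_gt_at_top[of "0::nat"]
  proof eventually_elim
    case (elim n)
    let ?a = "\<epsilon> * real n" and ?y = "x * sqrt (real n)" and ?D = "\<delta> * sqrt (real n)"
    have n: "0 < real n" using elim by simp
    have a: "0 < ?a" using n \<epsilon> by simp
    have sa: "sqrt (?a + real n) = sqrt (\<epsilon> + 1) * sqrt (real n)"
      unfolding real_sqrt_mult[symmetric] by (simp add: algebra_simps)
    have err: "real n * (step_error ?a / ?a) = step_error ?a / \<epsilon>" using n by simp
    have "half_normal (?y / sqrt (?a + real n)) - real n * (step_error ?a / ?a) \<le> v n ?y"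
      by (rule max_cdf_lower[OF v v01 v0 vSuc a])
    moreover have "?y / sqrt (?a + real n) = x / sqrt (\<epsilon> + 1)"
      unfolding sa using n by simp
    ultimately have lower: "half_normal x - e < v n ?y"
      using \<epsilon>(2) elim(1) e unfolding err by simp
    have up: "v n ?y \<le> half_normal ((?y + ?D) / sqrt (?a + real n)) + (1 - half_normal (?D / sqrt ?a))
       + real n * (step_error ?a / ?a + measure \<mu> {?D<..})"
    proof (rule max_cdf_upper[where v=v, OF v v01 vneg vSuc a])
      show "0 \<le> ?D" using \<delta>(1) by simp
      moreover have "0 \<le> ?y" using x by simp
      ultimately show "- ?D \<le> ?y" by linarith
    qed
    have e1: "(?y + ?D) / sqrt (?a + real n) = (x + \<delta>) / sqrt (\<epsilon> + 1)"
      unfolding sa using n by (simp add: distrib_right[symmetric])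
    have m1: "half_normal ((x + \<delta>) / sqrt (\<epsilon> + 1)) \<le> half_normal (x + \<delta>)"
    proof (rule mono_half_normal)
      have "(x + \<delta>) / sqrt (\<epsilon> + 1) \<le> (x + \<delta>) / 1"
        using x \<delta>(1) \<epsilon>(1) by (intro divide_left_mono) auto
      then show "(x + \<delta>) / sqrt (\<epsilon> + 1) \<le> x + \<delta>" by simp
    qed
    have e2: "?D / sqrt ?a = \<delta> / sqrt \<epsilon>"
      using n by (simp add: real_sqrt_mult)
    have e3: "real n * (step_error ?a / ?a + measure \<mu> {?D<..}) \<le> step_error ?a / \<epsilon> + trunc_moment (real n) / m"
      using tail_bound[OF n \<delta>(1)] unfolding distrib_left err m_def by simp
    have "v n ?y < half_normal x + e"
      using up[unfolded e1 e2] m1 e3 \<delta>(2) \<epsilon>(3) elim(1,2) by linarith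
    with lower show ?case by (simp add: dist_real_def abs_less_iff)
  qed
qed

end

section \<open>The running maximum of the walk\<close>

text \<open>
The maximum of \<open>0\<close> and the sums \<open>x (i + 1) + \<dots> + x (i + k)\<close> for \<open>1 \<le> k \<le> n\<close>, defined by splitting off
the first summand, as in the recursion of the distribution functions.
\<close>
primrec walk_max :: "nat \<Rightarrow> (nat \<Rightarrow> real) \<Rightarrow> nat \<Rightarrow> real" where
  "walk_max 0 x i = 0"
| "walk_max (Suc n) x i = max 0 (x (Suc i) + walk_max n x (Suc i))"

lemma walk_max_nonneg: "0 \<le> walk_max n x i"
  by (cases n) auto

lemma walk_max_le_iff:
  "walk_max n x i \<le> y \<longleftrightarrow> 0 \<le> y \<and> (\<forall>k\<in>{1..n}. (\<Sum>j\<in>{i<..i+k}. x j) \<le> y)"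
proof (induction n arbitrary: i y)
  case (Suc n)
  have split: "(\<Sum>j\<in>{i<..i+Suc k}. x j) = x (Suc i) + (\<Sum>j\<in>{Suc i<..Suc i+k}. x j)" for k
  proof -
    have "{i<..i+Suc k} = insert (Suc i) {Suc i<..Suc i+k}" by auto
    then show ?thesis by simp
  qed
  have idx: "(\<forall>k\<in>{1..Suc n}. P k) \<longleftrightarrow> P (Suc 0) \<and> (\<forall>k\<in>{1..n}. P (Suc k))" for P
  proof -
    have "{1..Suc n} = insert (Suc 0) (Suc ` {1..n})"
      by (auto simp: image_Suc_atLeastAtMost)
    then show ?thesis by (simp del: image_Suc_atLeastAtMost)
  qed
  have "walk_max (Suc n) x i \<le> y \<longleftrightarrow> 0 \<le> y \<and> walk_max n x (Suc i) \<le> y - x (Suc i)" by auto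
  also have "\<dots> \<longleftrightarrow> 0 \<le> y \<and> 0 \<le> y - x (Suc i) \<and> (\<forall>k\<in>{1..n}. (\<Sum>j\<in>{Suc i<..Suc i+k}. x j) \<le> y - x (Suc i))"
    unfolding Suc.IH ..
  also have "\<dots> \<longleftrightarrow> 0 \<le> y \<and> (\<forall>k\<in>{1..Suc n}. (\<Sum>j\<in>{i<..i+k}. x j) \<le> y)"
    unfolding idx split by (auto simp: le_diff_eq add.commute)
  finally show ?case .
qed simp

lemma walk_max_cong:
  "(\<And>k. i < k \<Longrightarrow> k \<le> i + n \<Longrightarrow> x k = y k) \<Longrightarrow> walk_max n x i = walk_max n y i"
proof (induction n arbitrary: i)
  case (Suc n)
  have "walk_max n x (Suc i) = walk_max n y (Suc i)" by (rule Suc.IH) (use Suc.prems in auto)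
  then show ?case using Suc.prems[of "Suc i"] by simp
qed simp

lemma measurable_walk_max:
  "{i<..i+n} \<subseteq> A \<Longrightarrow> (\<lambda>x. walk_max n x i) \<in> borel_measurable (PiM A (\<lambda>_. borel))"
proof (induction n arbitrary: i)
  case (Suc n)
  have "(\<lambda>x. walk_max n x (Suc i)) \<in> borel_measurable (PiM A (\<lambda>_. borel))"
    by (rule Suc.IH) (use Suc.prems in auto)
  moreover have "Suc i \<in> A" using Suc.prems by auto
  ultimately show ?case by simp
qed simp

text \<open>
The maximum over \<open>m + k\<close> steps is attained either during the first \<open>m\<close> steps or during the walk that
restarts after them.
\<close>
lemma walk_max_add:
  "walk_max (m + k) x i = max (walk_max m x i) ((\<Sum>j\<in>{i<..i+m}. x j) + walk_max k x (i + m))"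
proof (induction m arbitrary: i)
  case 0
  then show ?case by (simp add: walk_max_nonneg max.absorb2)
next
  case (Suc m)
  have "{i<..i+Suc m} = insert (Suc i) {Suc i<..Suc i+m}" by auto
  then have S: "(\<Sum>j\<in>{i<..i+Suc m}. x j) = x (Suc i) + (\<Sum>j\<in>{Suc i<..Suc i+m}. x j)" by simp
  show ?case
    using Suc.IH[of "Suc i"] walk_max_nonneg[of k x "Suc i + m"] unfolding S by simp
qed

context iid_walk
begin

abbreviation W :: "nat \<Rightarrow> nat \<Rightarrow> 'a \<Rightarrow> real" where
  "W n i \<omega> \<equiv> walk_max n (\<lambda>k. X k \<omega>) i"

lemma W_restrict: "{i<..i+n} \<subseteq> A \<Longrightarrow> W n i \<omega> = walk_max n (\<lambda>k\<in>A. X k \<omega>) i"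
  by (rule walk_max_cong) auto

lemma rv_W [measurable]: "random_variable borel (W n i)"
proof -
  have "(\<lambda>\<omega>. \<lambda>k\<in>{i<..i+n}. X k \<omega>) \<in> measurable M (PiM {i<..i+n} (\<lambda>_. borel))"
    by (intro measurable_restrict) auto
  from measurable_compose[OF this measurable_walk_max[OF order_refl]] show ?thesis
    by (simp add: W_restrict[OF order_refl, symmetric])
qed

lemma max_partial_sum_eq_W:
  assumes "1 \<le> n"
  shows "max 0 (max_partial_sum X n \<omega>) = W n 0 \<omega>"
proof -
  have eq: "{0<..0+k} = {1..k}" for k :: nat by auto
  have "max 0 (max_partial_sum X n \<omega>) \<le> y \<longleftrightarrow> W n 0 \<omega> \<le> y" for y
    unfolding walk_max_le_iff max_partial_sum_def partial_sum_def eq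
    using assms by (subst max.bounded_iff, subst Max_le_iff) auto
  then show ?thesis by (meson order.refl order.antisym)
qed

lemma indep_first_rest: "indep_var borel (X (Suc i)) borel (W n (Suc i))"
proof -
  have "indep_var borel (\<lambda>\<omega>. (\<lambda>x. x (Suc i)) (\<lambda>k\<in>{Suc i}. X k \<omega>))
    borel (\<lambda>\<omega>. (\<lambda>x. walk_max n x (Suc i)) (\<lambda>k\<in>{Suc i<..Suc i+n}. X k \<omega>))"
    by (rule indep_blocks) (auto intro!: measurable_walk_max)
  then show ?thesis by (simp add: W_restrict[OF order_refl, symmetric] del: add_Suc)
qed

lemma indep_past_future: "indep_var borel (W n m) borel (partial_sum X m)"
proof -
  have "indep_var borel (\<lambda>\<omega>. (\<lambda>x. walk_max n x m) (\<lambda>k\<in>{m<..m+n}. X k \<omega>))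
    borel (\<lambda>\<omega>. (\<lambda>x. \<Sum>j\<in>{1..m}. x j) (\<lambda>k\<in>{1..m}. X k \<omega>))"
    by (rule indep_blocks) (auto intro!: measurable_walk_max borel_measurable_sum)
  then show ?thesis by (simp add: W_restrict[OF order_refl, symmetric] partial_sum_def[abs_def])
qed

text \<open>
Conditioning on the first step: for \<open>y \<ge> 0\<close> the truncation at \<open>0\<close> in \<open>walk_max\<close> does not affect the event.
\<close>
lemma W_cdf_Suc:
  assumes y: "0 \<le> y"
  shows "prob {\<omega>\<in>space M. W (Suc n) i \<omega> \<le> y} = (\<integral>x. prob {\<omega>\<in>space M. W n (Suc i) \<omega> \<le> y - x} \<partial>\<mu>)"
proof -
  let ?V = "W n (Suc i)"
  interpret V: prob_space "distr M borel ?V" by (rule prob_space_distr) simp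
  have cdf: "(\<integral>v. indicator {..y} (u + v) \<partial>distr M borel ?V) = prob {\<omega>\<in>space M. ?V \<omega> \<le> y - u}" for u
  proof -
    have "(\<integral>v. indicator {..y} (u + v) \<partial>distr M borel ?V) = (\<integral>v. indicator {..y - u} v \<partial>distr M borel ?V :: real)"
      by (intro Bochner_Integration.integral_cong) (auto split: split_indicator)
    also have "\<dots> = measure (distr M borel ?V) {..y - u}" by simp
    also have "\<dots> = prob {\<omega>\<in>space M. ?V \<omega> \<le> y - u}"
      by (subst measure_distr) (auto intro!: arg_cong[of _ _ prob])
    finally show ?thesis .
  qed
  have "prob {\<omega>\<in>space M. W (Suc n) i \<omega> \<le> y} = expectation (\<lambda>\<omega>. indicator {..y} (X (Suc i) \<omega> + ?V \<omega>))"
  proof -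
    have "prob {\<omega>\<in>space M. W (Suc n) i \<omega> \<le> y} = expectation (indicator {\<omega>\<in>space M. W (Suc n) i \<omega> \<le> y})"
      by simp
    also have "\<dots> = expectation (\<lambda>\<omega>. indicator {..y} (X (Suc i) \<omega> + ?V \<omega>))"
      using y by (intro Bochner_Integration.integral_cong) (auto split: split_indicator)
    finally show ?thesis .
  qed
  also have "\<dots> = expectation (\<lambda>\<omega>. \<integral>v. indicator {..y} (X (Suc i) \<omega> + v) \<partial>distr M borel ?V)"
    using indep_var_expectation[OF indep_first_rest, of "\<lambda>(u, v). indicator {..y} (u + v)" 1]
    by (simp add: split_beta)
  also have "\<dots> = (\<integral>u. (\<integral>v. indicator {..y} (u + v) \<partial>distr M borel ?V) \<partial>distr M borel (X (Suc i)))"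
    by (rule integral_distr[symmetric]) auto
  also have "\<dots> = (\<integral>u. prob {\<omega>\<in>space M. ?V \<omega> \<le> y - u} \<partial>distr M borel (X (Suc i)))"
    unfolding cdf ..
  finally show ?thesis using ident[of "Suc i"] by simp
qed

lemma W_cdf_neg: "y < 0 \<Longrightarrow> prob {\<omega>\<in>space M. W n i \<omega> \<le> y} = 0"
proof -
  assume "y < 0"
  then have "{\<omega>\<in>space M. W n i \<omega> \<le> y} = {}" by (auto dest: order_trans[OF walk_max_nonneg])
  then show ?thesis by (simp del: Collect_empty_eq)
qed

lemma W_cdf_stationary: "prob {\<omega>\<in>space M. W n i \<omega> \<le> y} = prob {\<omega>\<in>space M. W n j \<omega> \<le> y}"
proof (induction n arbitrary: i j y)
  case (Suc n)
  show ?case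
  proof (cases "0 \<le> y")
    case True
    show ?thesis unfolding W_cdf_Suc[OF True] Suc.IH[of "Suc i" _ "Suc j"] ..
  next
    case False
    then show ?thesis by (simp add: W_cdf_neg del: walk_max.simps)
  qed
qed simp

end

locale standardized_walk = iid_walk M X for M :: "'a measure" and X +
  assumes std: "standardized_law (distr M borel (X 1))"
begin

theorem W_cdf_limit:
  assumes x: "0 \<le> x"
  shows "(\<lambda>n. prob {\<omega>\<in>space M. W n 0 \<omega> \<le> x * sqrt (real n)}) \<longlonglongrightarrow> half_normal x"
proof -
  interpret law: standardized_law \<mu> by (rule std)
  define v where "v n y = prob {\<omega>\<in>space M. W n 0 \<omega> \<le> y}" for n y
  have mono: "mono (v n)" for n
    unfolding v_def by (intro monoI finite_measure_mono) auto
  show ?thesis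
    unfolding v_def[symmetric]
  proof (rule law.max_cdf_limit)
    show "v j \<in> borel_measurable borel" for j by (rule borel_measurable_mono[OF mono])
    show "0 \<le> v j y \<and> v j y \<le> 1" for j y by (simp add: v_def)
    show "v 0 y = 1" if "0 \<le> y" for y using that by (simp add: v_def prob_space)
    show "v j y = 0" if "y < 0" for j y unfolding v_def by (rule W_cdf_neg[OF that])
    show "v (Suc j) y = (\<integral>x. v j (y - x) \<partial>\<mu>)" if "0 \<le> y" for j y
      unfolding v_def W_cdf_Suc[OF that] W_cdf_stationary[of j "Suc 0" _ 0] ..
  qed (rule x)
qed

lemma second_moment_partial_sum:
  "integrable M (\<lambda>\<omega>. (partial_sum X n \<omega>)\<^sup>2)" "expectation (\<lambda>\<omega>. (partial_sum X n \<omega>)\<^sup>2) = real n"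
  "integrable M (partial_sum X n)" "expectation (partial_sum X n) = 0"
proof -
  interpret law: standardized_law \<mu> by (rule std)
  have X: "integrable M (X (Suc k))" "expectation (X (Suc k)) = 0"
    "integrable M (\<lambda>\<omega>. (X (Suc k) \<omega>)\<^sup>2)" "expectation (\<lambda>\<omega>. (X (Suc k) \<omega>)\<^sup>2) = 1" for k
  proof -
    have eq: "distr M borel (X (Suc k)) = \<mu>" by (rule ident) simp
    show "integrable M (X (Suc k))"
      using law.integrable_id unfolding eq[symmetric] by (subst (asm) integrable_distr_eq) auto
    show "expectation (X (Suc k)) = 0"
      using law.mean unfolding eq[symmetric] by (subst (asm) integral_distr) auto
    show "integrable M (\<lambda>\<omega>. (X (Suc k) \<omega>)\<^sup>2)"
      using law.integrable_square unfolding eq[symmetric] by (subst (asm) integrable_distr_eq) auto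
    show "expectation (\<lambda>\<omega>. (X (Suc k) \<omega>)\<^sup>2) = 1"
      using law.second_moment unfolding eq[symmetric] by (subst (asm) integral_distr) auto
  qed
  have "integrable M (\<lambda>\<omega>. (partial_sum X n \<omega>)\<^sup>2) \<and> expectation (\<lambda>\<omega>. (partial_sum X n \<omega>)\<^sup>2) = real n
    \<and> integrable M (partial_sum X n) \<and> expectation (partial_sum X n) = 0"
  proof (induction n)
    case 0
    then show ?case by (simp add: partial_sum_def[abs_def])
  next
    case (Suc n)
    have cross: "integrable M (\<lambda>\<omega>. partial_sum X n \<omega> * X (Suc n) \<omega>)"
      "expectation (\<lambda>\<omega>. partial_sum X n \<omega> * X (Suc n) \<omega>) = 0"
      using indep_var_integrable[OF indep_partial_sum_next] indep_var_lebesgue_integral[OF indep_partial_sum_next]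
        Suc X by auto
    have "(partial_sum X (Suc n) \<omega>)\<^sup>2 = (partial_sum X n \<omega>)\<^sup>2 + 2 * (partial_sum X n \<omega> * X (Suc n) \<omega>) + (X (Suc n) \<omega>)\<^sup>2" for \<omega>
      by (simp add: partial_sum_Suc power2_sum)
    then show ?case
      using Suc X cross by (simp add: partial_sum_Suc[abs_def])
  qed
  then show "integrable M (\<lambda>\<omega>. (partial_sum X n \<omega>)\<^sup>2)" "expectation (\<lambda>\<omega>. (partial_sum X n \<omega>)\<^sup>2) = real n"
    "integrable M (partial_sum X n)" "expectation (partial_sum X n) = 0" by auto
qed

lemma partial_sum_lower_tail:
  assumes c: "0 < c"
  shows "prob {\<omega>\<in>space M. partial_sum X m \<omega> < - c} \<le> real m / c\<^sup>2"
proof -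
  have "prob {\<omega>\<in>space M. partial_sum X m \<omega> < - c} \<le> prob {\<omega>\<in>space M. c\<^sup>2 \<le> (partial_sum X m \<omega>)\<^sup>2}"
  proof (intro finite_measure_mono)
    show "{\<omega>\<in>space M. partial_sum X m \<omega> < - c} \<subseteq> {\<omega>\<in>space M. c\<^sup>2 \<le> (partial_sum X m \<omega>)\<^sup>2}"
      using c by (auto intro!: abs_le_square_iff[THEN iffD1])
  qed auto
  also have "\<dots> \<le> expectation (\<lambda>\<omega>. (partial_sum X m \<omega>)\<^sup>2) / c\<^sup>2"
    using c second_moment_partial_sum by (intro integral_Markov_inequality_measure[where A="{}"]) auto
  finally show ?thesis by (simp add: second_moment_partial_sum)
qed

text \<open>
Take \<open>K = L ^ 4\<close> and \<open>m = n div K\<close>, so that \<open>sqrt m\<close> is about \<open>sqrt n / L\<^sup>2\<close>, and compare at the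
intermediate scale \<open>a = sqrt n / L\<close>.  The maximum up to time \<open>m\<close> exceeds the later one only if it is
larger than \<open>a\<close>, which is about \<open>L sqrt m\<close>, or \<open>S\<^sub>m < - a\<close>, or the maximum of the restarted walk is at
most \<open>2 a\<close>, a small multiple of \<open>sqrt n\<close>.  The limits of the three probabilities are bounded by
\<open>1 - half_normal L\<close>, \<open>1 / L\<^sup>2\<close> and \<open>half_normal (4 / L)\<close>.
\<close>
lemma early_maximum_unlikely:
  assumes \<eta>: "0 < \<eta>"
  obtains K :: nat where "2 \<le> K"
    "\<forall>\<^sub>F n in sequentially. prob {\<omega>\<in>space M. partial_sum X (n div K) \<omega> + W (n - n div K) (n div K) \<omega> < W (n div K) 0 \<omega>} < \<eta>"
proof -
  have real_L: "filterlim (\<lambda>L::nat. real L) at_top sequentially" by (rule filterlim_real_sequentially)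
  have "(\<lambda>L. (1 - half_normal (real L)) + 1 / (real L)\<^sup>2 + half_normal (4 / real L)) \<longlonglongrightarrow> (1 - 1) + 0 + half_normal 0"
    by (intro tendsto_intros filterlim_compose[OF half_normal_at_top real_L]
        isCont_tendsto_compose[OF isCont_half_normal] real_tendsto_divide_at_top[OF tendsto_const]
        filterlim_pow_at_top real_L) auto
  then have "\<forall>\<^sub>F L in sequentially. (1 - half_normal (real L)) + 1 / (real L)\<^sup>2 + half_normal (4 / real L) < \<eta>"
    using \<eta> by (intro order_tendstoD) auto
  with eventually_ge_at_top[of "2::nat"] have "\<forall>\<^sub>F L in sequentially. 2 \<le> L \<and> (1 - half_normal (real L)) + 1 / (real L)\<^sup>2 + half_normal (4 / real L) < \<eta>"
    by eventually_elim simp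
  then obtain L :: nat where L: "2 \<le> L" "(1 - half_normal (real L)) + 1 / (real L)\<^sup>2 + half_normal (4 / real L) < \<eta>"
    by (auto simp: eventually_sequentially)
  define K where "K = L ^ 4"
  have K2: "2 \<le> K" using L power_increasing[of 1 4 L] by (simp add: K_def)
  have sK: "sqrt (real K) = (real L)\<^sup>2"
    by (simp add: K_def real_sqrt_unique power_mult[symmetric] flip: power_mult)
  define m where "m n = n div K" for n
  define k where "k n = n - m n" for n
  have m_lim: "filterlim m at_top sequentially"
    unfolding m_def using K2 by (intro filterlim_at_top_div_const_nat) auto
  have mle: "K * m n \<le> n" for n unfolding m_def by simp
  have n2k: "n \<le> 2 * k n" for n
  proof -
    have "2 * m n \<le> K * m n" using K2 by (rule mult_right_mono) simp
    then show ?thesis using mle[of n] unfolding k_def by linarith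
  qed
  have k_lim: "filterlim k at_top sequentially"
    unfolding filterlim_at_top
  proof
    fix Z :: nat
    show "\<forall>\<^sub>F n in sequentially. Z \<le> k n"
      using eventually_ge_at_top[of "2 * Z"]
    proof eventually_elim
      case (elim n)
      then show ?case using n2k[of n] by linarith
    qed
  qed
  let ?v = "\<lambda>n y. prob {\<omega>\<in>space M. W n 0 \<omega> \<le> y}"
  have lim1: "(\<lambda>n. ?v (m n) (real L * sqrt (real (m n)))) \<longlonglongrightarrow> half_normal (real L)"
    by (rule filterlim_compose[OF W_cdf_limit m_lim]) simp
  have lim2: "(\<lambda>n. ?v (k n) (4 / real L * sqrt (real (k n)))) \<longlonglongrightarrow> half_normal (4 / real L)"
    by (rule filterlim_compose[OF W_cdf_limit k_lim]) simp
  have "(\<lambda>n. (1 - ?v (m n) (real L * sqrt (real (m n)))) + 1 / (real L)\<^sup>2 + ?v (k n) (4 / real L * sqrt (real (k n))))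
     \<longlonglongrightarrow> (1 - half_normal (real L)) + 1 / (real L)\<^sup>2 + half_normal (4 / real L)"
    by (intro tendsto_intros lim1 lim2)
  then have ev: "\<forall>\<^sub>F n in sequentially. (1 - ?v (m n) (real L * sqrt (real (m n)))) + 1 / (real L)\<^sup>2
      + ?v (k n) (4 / real L * sqrt (real (k n))) < \<eta>"
    using L(2) by (rule order_tendstoD)
  show ?thesis
  proof (rule that[OF K2], unfold m_def[symmetric], unfold k_def[symmetric])
    show "\<forall>\<^sub>F n in sequentially. prob {\<omega>\<in>space M. partial_sum X (m n) \<omega> + W (k n) (m n) \<omega> < W (m n) 0 \<omega>} < \<eta>"
      using ev eventually_gt_at_top[of "0::nat"]
    proof eventually_elim
      case (elim n)
      define a where "a = sqrt (real n) / real L"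
      have a: "0 < a" using elim(2) L(1) by (simp add: a_def)
      have b1: "real L * sqrt (real (m n)) \<le> a"
      proof -
        have "sqrt (real K) * sqrt (real (m n)) \<le> sqrt (real n)"
          unfolding real_sqrt_mult[symmetric] using mle[of n] by (intro real_sqrt_le_mono) (metis of_nat_le_iff of_nat_mult)
        then show ?thesis using L(1) unfolding sK a_def by (simp add: field_simps power2_eq_square)
      qed
      have b2: "2 * a \<le> 4 / real L * sqrt (real (k n))"
      proof -
        have "sqrt (real n) \<le> sqrt (4 * real (k n))"
          using n2k[of n] by (intro real_sqrt_le_mono) linarith
        then have "sqrt (real n) \<le> 2 * sqrt (real (k n))" by (simp add: real_sqrt_mult)
        then show ?thesis using L(1) unfolding a_def by (simp add: field_simps)
      qed
      let ?A = "{\<omega>\<in>space M. \<not> W (m n) 0 \<omega> \<le> real L * sqrt (real (m n))}"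
      let ?B = "{\<omega>\<in>space M. partial_sum X (m n) \<omega> < - a}"
      let ?C = "{\<omega>\<in>space M. W (k n) (m n) \<omega> \<le> 4 / real L * sqrt (real (k n))}"
      have "prob {\<omega>\<in>space M. partial_sum X (m n) \<omega> + W (k n) (m n) \<omega> < W (m n) 0 \<omega>} \<le> prob (?A \<union> ?B \<union> ?C)"
        using b1 b2 by (intro finite_measure_mono) auto
      also have "\<dots> \<le> prob ?A + prob ?B + prob ?C"
        by (rule order_trans[OF measure_subadditive] add_mono)+ (auto intro: measure_subadditive)
      also have "prob ?A = 1 - ?v (m n) (real L * sqrt (real (m n)))"
        by (rule prob_neg) measurable
      also have "prob ?C = ?v (k n) (4 / real L * sqrt (real (k n)))"
        by (rule W_cdf_stationary)
      also have "prob ?B \<le> 1 / (real L)\<^sup>2"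
      proof -
        have "prob ?B \<le> real (m n) / a\<^sup>2" by (rule partial_sum_lower_tail[OF a])
        also have "\<dots> \<le> 1 / (real L)\<^sup>2"
        proof -
          have "real (m n) * real K \<le> real n" using mle[of n] by (metis mult.commute of_nat_le_iff of_nat_mult)
          then have "real (m n) * ((real L)\<^sup>2 * (real L)\<^sup>2) \<le> real n" by (simp add: K_def flip: power_add)
          then show ?thesis using L(1) elim(2) by (simp add: a_def power_divide field_simps)
        qed
        finally show ?thesis .
      qed
      finally show ?case using elim(1) by simp
    qed
  qed
qed

end

section \<open>Translating the law of the maximum\<close>

lemma (in prob_space) coupling_inequality:
  fixes g :: "real \<Rightarrow> real"
  assumes [measurable]: "random_variable borel U" "random_variable borel V" "g \<in> borel_measurable borel" "B \<in> events"
    and g: "\<And>x. \<bar>g x\<bar> \<le> 1" and eq: "\<And>\<omega>. \<omega> \<in> space M \<Longrightarrow> \<omega> \<notin> B \<Longrightarrow> U \<omega> = V \<omega>"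
  shows "\<bar>expectation (\<lambda>\<omega>. g (U \<omega>)) - expectation (\<lambda>\<omega>. g (V \<omega>))\<bar> \<le> 2 * prob B"
proof -
  have int: "integrable M (\<lambda>\<omega>. g (U \<omega>))" "integrable M (\<lambda>\<omega>. g (V \<omega>))"
    by (auto intro!: integrable_const_bound[of _ 1] simp: g)
  have "\<bar>expectation (\<lambda>\<omega>. g (U \<omega>)) - expectation (\<lambda>\<omega>. g (V \<omega>))\<bar> = \<bar>expectation (\<lambda>\<omega>. g (U \<omega>) - g (V \<omega>))\<bar>"
    using int by simp
  also have "\<dots> \<le> expectation (\<lambda>\<omega>. \<bar>g (U \<omega>) - g (V \<omega>)\<bar>)" by (rule integral_abs_bound)
  also have "\<dots> \<le> expectation (\<lambda>\<omega>. 2 * indicator B \<omega>)"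
  proof (rule integral_mono)
    show "integrable M (\<lambda>\<omega>. \<bar>g (U \<omega>) - g (V \<omega>)\<bar>)" using int by auto
    show "integrable M (\<lambda>\<omega>. 2 * indicator B \<omega> :: real)"
      by (intro integrable_mult_right integrable_const_bound[of _ 1]) auto
    show "\<bar>g (U \<omega>) - g (V \<omega>)\<bar> \<le> 2 * indicator B \<omega>" if "\<omega> \<in> space M" for \<omega>
    proof (cases "\<omega> \<in> B")
      case True
      then show ?thesis using g[of "U \<omega>"] g[of "V \<omega>"] by simp
    next
      case False
      then show ?thesis using eq[OF that] by simp
    qed
  qed
  finally show ?thesis by simp
qed

locale standardized_density_walk = density_walk M X f + standardized_walk M X
  for M :: "'a measure" and X and f :: "real \<Rightarrow> real"
begin

text \<open>
Off the event of \<open>early_maximum_unlikely\<close>, \<open>W\<^sub>n = S\<^sub>m + V\<close> with \<open>V\<close> independent of \<open>S\<^sub>m\<close>.  Conditionally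
on \<open>V\<close>, \<open>shift_bound\<close> applies to \<open>S\<^sub>m\<close> with displacement \<open>t sqrt n\<close>, and \<open>m \<ge> n / (2 K)\<close> makes its
bound \<open>O (t + 1 / sqrt n)\<close>.
\<close>
lemma asymptotic_shift_continuity:
  assumes \<eta>: "0 < \<eta>"
  obtains t0 where "0 < t0"
    "\<forall>\<^sub>F n in sequentially. \<forall>t (g :: real \<Rightarrow> real). 0 \<le> t \<longrightarrow> t \<le> t0 \<longrightarrow> g \<in> borel_measurable borel \<longrightarrow> (\<forall>x. \<bar>g x\<bar> \<le> 1) \<longrightarrow>
       \<bar>expectation (\<lambda>\<omega>. g (W n 0 \<omega> / sqrt (real n) + t)) - expectation (\<lambda>\<omega>. g (W n 0 \<omega> / sqrt (real n)))\<bar> \<le> \<eta>"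
proof -
  obtain C where C: "0 < C"
    "\<And>n h (g :: real \<Rightarrow> real) c. \<lbrakk>1 \<le> n; 0 \<le> h; g \<in> borel_measurable borel; \<And>x. \<bar>g x\<bar> \<le> c\<rbrakk> \<Longrightarrow>
       \<bar>expectation (\<lambda>\<omega>. g (partial_sum X n \<omega> + h)) - expectation (\<lambda>\<omega>. g (partial_sum X n \<omega>))\<bar>
         \<le> c * C * (1 + h) / sqrt (real n)"
    using shift_bound by metis
  obtain K :: nat where K: "2 \<le> K"
    and bad: "\<forall>\<^sub>F n in sequentially. prob {\<omega>\<in>space M. partial_sum X (n div K) \<omega> + W (n - n div K) (n div K) \<omega> < W (n div K) 0 \<omega>} < \<eta> / 8"
    using early_maximum_unlikely[of "\<eta> / 8"] \<eta> by auto
  define c where "c = C * sqrt (2 * real K)"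
  have c: "0 < c" using C(1) K by (simp add: c_def)
  have "(\<lambda>n. c / sqrt (real n)) \<longlonglongrightarrow> 0"
    by (intro real_tendsto_divide_at_top[OF tendsto_const] filterlim_compose[OF sqrt_at_top filterlim_real_sequentially])
  then have small: "\<forall>\<^sub>F n in sequentially. c / sqrt (real n) < \<eta> / 4"
    using \<eta> by (intro order_tendstoD) auto
  show ?thesis
  proof (rule that[of "\<eta> / (4 * c)"])
    show "0 < \<eta> / (4 * c)" using \<eta> c by simp
    show "\<forall>\<^sub>F n in sequentially. \<forall>t (g :: real \<Rightarrow> real). 0 \<le> t \<longrightarrow> t \<le> \<eta> / (4 * c) \<longrightarrow> g \<in> borel_measurable borel \<longrightarrow> (\<forall>x. \<bar>g x\<bar> \<le> 1) \<longrightarrow>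
       \<bar>expectation (\<lambda>\<omega>. g (W n 0 \<omega> / sqrt (real n) + t)) - expectation (\<lambda>\<omega>. g (W n 0 \<omega> / sqrt (real n)))\<bar> \<le> \<eta>"
      using bad small eventually_ge_at_top[of K]
    proof eventually_elim
      case (elim n)
      define m where "m = n div K"
      define k where "k = n - m"
      define r where "r = sqrt (real n)"
      have m1: "1 \<le> m" using elim(3) K unfolding m_def by (simp add: div_greater_zero_iff Suc_le_eq)
      have nmk: "n = m + k" unfolding k_def m_def by simp
      have n2: "n \<le> 2 * K * m"
      proof -
        have "n < K * m + K" unfolding m_def using K by (metis dividend_less_times_div gr0I not_numeral_le_zero add.commute mult.commute)
        moreover have "K * 1 \<le> K * m" using m1 by (intro mult_left_mono) auto
        ultimately have "n < K * m + K * m" by linarith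
        then show ?thesis by simp
      qed
      have r: "0 < r" using elim(3) K by (simp add: r_def)
      let ?S = "\<lambda>\<omega>. partial_sum X m \<omega>" and ?V = "W k m"
      let ?B = "{\<omega>\<in>space M. ?S \<omega> + ?V \<omega> < W m 0 \<omega>}"
      have B: "prob ?B < \<eta> / 8" using elim(1) unfolding m_def[symmetric] k_def[symmetric] .
      have Wn: "W n 0 \<omega> = max (W m 0 \<omega>) (?S \<omega> + ?V \<omega>)" for \<omega>
      proof -
        have "{0<..0+m} = {1..m}" by auto
        then show ?thesis unfolding nmk walk_max_add by (simp add: partial_sum_def)
      qed
      show ?case
        unfolding r_def[symmetric]
      proof (intro allI impI)
        fix t :: real and g :: "real \<Rightarrow> real"
        assume t: "0 \<le> t" "t \<le> \<eta> / (4 * c)" and g[measurable]: "g \<in> borel_measurable borel" and g1: "\<forall>x. \<bar>g x\<bar> \<le> 1"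
        have near: "\<bar>expectation (\<lambda>\<omega>. g (W n 0 \<omega> / r + s)) - expectation (\<lambda>\<omega>. g ((?S \<omega> + ?V \<omega>) / r + s))\<bar> \<le> 2 * prob ?B" for s
          by (rule coupling_inequality) (use g1 Wn in auto)
        have cond: "expectation (\<lambda>\<omega>. g ((?S \<omega> + ?V \<omega>) / r + s)) =
           expectation (\<lambda>\<omega>. \<integral>y. g ((y + ?V \<omega>) / r + s) \<partial>distr M borel ?S)" for s
          using indep_var_expectation[OF indep_past_future[of k m], of "\<lambda>(v, y). g ((y + v) / r + s)" 1] g1
          by (simp add: split_beta)
        interpret S: prob_space "distr M borel ?S" by (rule prob_space_distr) simp
        let ?I = "\<lambda>s \<omega>. \<integral>y. g ((y + ?V \<omega>) / r + s) \<partial>distr M borel ?S"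
        have I1: "\<bar>?I s \<omega>\<bar> \<le> 1" for s \<omega> using g1 by (intro S.expectation_abs_le) auto
        have Iint: "integrable M (?I s)" for s
          by (rule integrable_const_bound[of _ 1]) (use I1 in auto)
        have step: "\<bar>?I t \<omega> - ?I 0 \<omega>\<bar> \<le> \<eta> / 2" for \<omega>
        proof -
          let ?g = "\<lambda>y. g ((y + ?V \<omega>) / r)"
          have E: "?I s \<omega> = expectation (\<lambda>\<omega>'. ?g (?S \<omega>' + s * r))" for s
          proof -
            have "?I s \<omega> = expectation (\<lambda>\<omega>'. g ((?S \<omega>' + ?V \<omega>) / r + s))"
              by (rule integral_distr) auto
            moreover have "(y + ?V \<omega>) / r + s = (y + s * r + ?V \<omega>) / r" for y
              using r by (simp add: add_divide_distrib)
            ultimately show ?thesis by simp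
          qed
          have "\<bar>?I t \<omega> - ?I 0 \<omega>\<bar> = \<bar>expectation (\<lambda>\<omega>'. ?g (?S \<omega>' + t * r)) - expectation (\<lambda>\<omega>'. ?g (?S \<omega>'))\<bar>"
            using E[of t] E[of 0] by simp
          also have "\<dots> \<le> 1 * C * (1 + t * r) / sqrt (real m)"
            using t r g1 by (intro C(2) m1) auto
          also have "\<dots> \<le> 1 * C * (1 + t * r) / (r / sqrt (2 * real K))"
          proof (rule divide_left_mono)
            have "r \<le> sqrt (2 * real K * real m)"
              unfolding r_def using n2 by (intro real_sqrt_le_mono) (metis of_nat_le_iff of_nat_mult of_nat_numeral)
            then show "r / sqrt (2 * real K) \<le> sqrt (real m)"
              using K by (simp add: real_sqrt_mult pos_divide_le_eq mult.commute)
          qed (use t r C(1) m1 K in auto)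
          also have "\<dots> = c / r + c * t"
            using r by (simp add: c_def field_simps)
          also have "\<dots> \<le> \<eta> / 4 + \<eta> / 4"
          proof (rule add_mono)
            show "c / r \<le> \<eta> / 4" using elim(2) by (simp add: r_def)
            show "c * t \<le> \<eta> / 4" using t(2) c by (simp add: field_simps)
          qed
          finally show ?thesis by simp
        qed
        have "\<bar>expectation (?I t) - expectation (?I 0)\<bar> = \<bar>expectation (\<lambda>\<omega>. ?I t \<omega> - ?I 0 \<omega>)\<bar>"
          using Iint[of t] Iint[of 0] by (subst Bochner_Integration.integral_diff) (simp_all only: refl)
        also have "\<dots> \<le> \<eta> / 2" by (rule expectation_abs_le) (rule step)
        finally have "\<bar>expectation (\<lambda>\<omega>. g ((?S \<omega> + ?V \<omega>) / r + t)) - expectation (\<lambda>\<omega>. g ((?S \<omega> + ?V \<omega>) / r + 0))\<bar> \<le> \<eta> / 2"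
          unfolding cond .
        then show "\<bar>expectation (\<lambda>\<omega>. g (W n 0 \<omega> / r + t)) - expectation (\<lambda>\<omega>. g (W n 0 \<omega> / r))\<bar> \<le> \<eta>"
          using near[of t] near[of 0] B unfolding add_0_right by linarith
      qed
    qed
  qed
qed

end

section \<open>From distribution functions to total variation\<close>

context real_distribution
begin

text \<open>
The density of \<open>Y + U\<close>, where \<open>Y\<close> has law \<open>M\<close> and \<open>U\<close> is independent of \<open>Y\<close> and uniform on \<open>[0, h)\<close>.
\<close>
definition smooth_density :: "real \<Rightarrow> real \<Rightarrow> real" where
  "smooth_density h x = (cdf M x - cdf M (x - h)) / h"

lemma smooth_density_nonneg: "0 < h \<Longrightarrow> 0 \<le> smooth_density h x"
  using cdf_nondecreasing[of "x - h" x] by (simp add: smooth_density_def)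

text \<open>
Fubini's theorem, applied before and after the substitution \<open>x = y + t\<close>: the smoothed law is the
average of the translates of the original one.
\<close>
lemma smooth_density_integral:
  assumes h: "0 < h" and A [measurable]: "A \<in> sets borel"
  shows "integrable lborel (\<lambda>x. indicator A x * smooth_density h x)"
    and "(\<integral>x. indicator A x * smooth_density h x \<partial>lborel) =
       (\<integral>t. indicator {0..<h} t / h * prob ((\<lambda>y. y + t) -` A) \<partial>lborel)"
proof -
  interpret P: pair_sigma_finite M lborel ..
  define k where "k t = (indicator {0..<h} t / h :: real)" for t
  have k0: "0 \<le> k t" for t using h by (simp add: k_def)
  have [measurable]: "k \<in> borel_measurable borel" unfolding k_def by measurable
  let ?f = "\<lambda>y x :: real. indicator A x * k (x - y)"
  let ?f' = "\<lambda>y t :: real. indicator A (y + t) * k t"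
  have "k = (\<lambda>t. indicator {0..<h} t / h)" by (auto simp: k_def)
  then have kern: "integrable lborel k" "integral\<^sup>L lborel k = 1"
    using h by simp_all
  have kern_shift: "integrable lborel (\<lambda>x. k (x - y))" "(\<integral>x. k (x - y) \<partial>lborel) = 1" for y
    using lborel_integrable_real_affine[OF kern(1), of 1 "-y"] lborel_integral_shift[of k "-y"] kern(2)
    by simp_all
  have fx: "integrable lborel (?f y)" for y
    by (rule Bochner_Integration.integrable_bound[OF kern_shift(1)[of y]])
      (auto split: split_indicator)
  have fx': "integrable lborel (?f' y)" for y
    by (rule Bochner_Integration.integrable_bound[OF kern(1)])
      (auto split: split_indicator)
  have le1: "\<bar>\<integral>x. norm (?f y x) \<partial>lborel\<bar> \<le> 1" "\<bar>\<integral>x. norm (?f' y x) \<partial>lborel\<bar> \<le> 1" for y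
  proof -
    have "(\<integral>x. norm (?f y x) \<partial>lborel) \<le> (\<integral>x. k (x - y) \<partial>lborel)"
      using fx[of y] kern_shift(1)[of y] k0 by (intro integral_mono) (auto split: split_indicator)
    moreover have "(\<integral>x. norm (?f' y x) \<partial>lborel) \<le> integral\<^sup>L lborel k"
      using fx'[of y] kern(1) k0 by (intro integral_mono) (auto split: split_indicator)
    moreover have "0 \<le> (\<integral>x. norm (?f y x) \<partial>lborel)" "0 \<le> (\<integral>x. norm (?f' y x) \<partial>lborel)"
      by (intro Bochner_Integration.integral_nonneg norm_ge_zero)+
    ultimately show "\<bar>\<integral>x. norm (?f y x) \<partial>lborel\<bar> \<le> 1" "\<bar>\<integral>x. norm (?f' y x) \<partial>lborel\<bar> \<le> 1"
      unfolding kern(2) kern_shift(2) by linarith+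
  qed
  have f: "integrable (M \<Otimes>\<^sub>M lborel) (case_prod ?f)"
    by (rule P.Fubini_integrable) (use le1(1) fx in \<open>auto intro!: integrable_const_bound[of _ 1]\<close>)
  have f': "integrable (M \<Otimes>\<^sub>M lborel) (case_prod ?f')"
    by (rule P.Fubini_integrable) (use le1(2) fx' in \<open>auto intro!: integrable_const_bound[of _ 1]\<close>)
  have inner: "(\<integral>y. ?f y x \<partial>M) = indicator A x * smooth_density h x" for x
  proof -
    have "(\<integral>y. ?f y x \<partial>M) = (\<integral>y. indicator A x / h * indicator {x - h<..x} y \<partial>M)"
      by (intro Bochner_Integration.integral_cong) (auto simp: k_def split: split_indicator)
    also have "\<dots> = indicator A x / h * prob {x - h<..x}" by simp
    also have "prob {x - h<..x} = cdf M x - cdf M (x - h)"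
      using h by (intro cdf_diff_eq[symmetric]) simp
    finally show ?thesis by (simp add: smooth_density_def)
  qed
  have inner': "(\<integral>y. ?f' y t \<partial>M) = k t * prob ((\<lambda>y. y + t) -` A)" for t
  proof -
    have [measurable]: "(\<lambda>y. y + t) -` A \<in> sets borel"
      using measurable_sets[of "\<lambda>y. y + t" borel borel A] by simp
    have "(\<integral>y. ?f' y t \<partial>M) = (\<integral>y. k t * indicator ((\<lambda>y. y + t) -` A) y \<partial>M)"
      by (intro Bochner_Integration.integral_cong) (auto simp: k_def split: split_indicator)
    then show ?thesis by (simp add: k_def)
  qed
  have xy: "(\<integral>x. ?f y x \<partial>lborel) = (\<integral>t. ?f' y t \<partial>lborel)" for y
    using lborel_integral_shift[of "?f y" y] by (simp add: add.commute)
  show "integrable lborel (\<lambda>x. indicator A x * smooth_density h x)"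
    using P.integrable_snd[OF f] unfolding inner .
  have "(\<integral>x. indicator A x * smooth_density h x \<partial>lborel) = (\<integral>x. \<integral>y. ?f y x \<partial>M \<partial>lborel)"
    unfolding inner ..
  also have "\<dots> = (\<integral>y. \<integral>x. ?f y x \<partial>lborel \<partial>M)" by (rule P.Fubini_integral[OF f])
  also have "\<dots> = (\<integral>y. \<integral>t. ?f' y t \<partial>lborel \<partial>M)" unfolding xy ..
  also have "\<dots> = (\<integral>t. \<integral>y. ?f' y t \<partial>M \<partial>lborel)" by (rule P.Fubini_integral[OF f', symmetric])
  also have "\<dots> = (\<integral>t. indicator {0..<h} t / h * prob ((\<lambda>y. y + t) -` A) \<partial>lborel)" unfolding inner' k_def[symmetric] ..
  finally show "(\<integral>x. indicator A x * smooth_density h x \<partial>lborel) = \<dots>" .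
qed

lemma smooth_density_total:
  assumes h: "0 < h"
  shows "integrable lborel (smooth_density h)" "integral\<^sup>L lborel (smooth_density h) = 1"
  using smooth_density_integral[OF h, of UNIV] h prob_space by auto

lemma smoothing_error:
  assumes h: "0 < h" and A [measurable]: "A \<in> sets borel"
    and \<eta>: "\<And>t. 0 \<le> t \<Longrightarrow> t \<le> h \<Longrightarrow> \<bar>prob ((\<lambda>y. y + t) -` A) - prob A\<bar> \<le> \<eta>"
  shows "\<bar>(\<integral>x. indicator A x * smooth_density h x \<partial>lborel) - prob A\<bar> \<le> \<eta>"
proof -
  define k where "k t = (indicator {0..<h} t / h :: real)" for t
  have k: "0 \<le> k t" "k t \<noteq> 0 \<Longrightarrow> 0 \<le> t \<and> t \<le> h" for t
    using h by (auto simp: k_def split: split_indicator_asm)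
  have [measurable]: "k \<in> borel_measurable borel" unfolding k_def by measurable
  have "k = (\<lambda>t. indicator {0..<h} t / h)" by (auto simp: k_def)
  then have kern: "integrable lborel k" "integral\<^sup>L lborel k = 1"
    using h by simp_all
  have m: "(\<lambda>t. prob ((\<lambda>y. y + t) -` A)) \<in> borel_measurable borel"
  proof -
    have "(\<lambda>t. \<integral>y. indicator A (y + t) \<partial>M :: real) \<in> borel_measurable borel" by measurable
    moreover have "(\<integral>y. indicator A (y + t) \<partial>M :: real) = prob ((\<lambda>y. y + t) -` A)" for t
    proof -
      have [measurable]: "(\<lambda>y. y + t) -` A \<in> sets borel"
        using measurable_sets[of "\<lambda>y. y + t" borel borel A] by simp
      have "(\<integral>y. indicator A (y + t) \<partial>M) = (\<integral>y. indicator ((\<lambda>y. y + t) -` A) y \<partial>M :: real)"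
        by (intro Bochner_Integration.integral_cong) (auto split: split_indicator)
      then show ?thesis by simp
    qed
    ultimately show ?thesis by simp
  qed
  note m[measurable]
  have int: "integrable lborel (\<lambda>t. k t * prob ((\<lambda>y. y + t) -` A))"
    by (rule Bochner_Integration.integrable_bound[OF kern(1)])
      (auto simp: abs_mult intro!: mult_left_le)
  have "(\<integral>x. indicator A x * smooth_density h x \<partial>lborel) - prob A =
     (\<integral>t. k t * prob ((\<lambda>y. y + t) -` A) \<partial>lborel) - (\<integral>t. k t * prob A \<partial>lborel)"
    unfolding smooth_density_integral(2)[OF h A] k_def[symmetric] using kern by simp
  also have "\<dots> = (\<integral>t. k t * (prob ((\<lambda>y. y + t) -` A) - prob A) \<partial>lborel)"
    using int kern by (simp add: right_diff_distrib)
  finally have "\<bar>(\<integral>x. indicator A x * smooth_density h x \<partial>lborel) - prob A\<bar> \<le>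
     (\<integral>t. \<bar>k t * (prob ((\<lambda>y. y + t) -` A) - prob A)\<bar> \<partial>lborel)"
    by (simp only: integral_abs_bound)
  also have "\<dots> \<le> (\<integral>t. k t * \<eta> \<partial>lborel)"
  proof (rule integral_mono)
    show "integrable lborel (\<lambda>t. \<bar>k t * (prob ((\<lambda>y. y + t) -` A) - prob A)\<bar>)"
      using int kern by (simp add: right_diff_distrib)
    show "integrable lborel (\<lambda>t. k t * \<eta>)" using kern by simp
    show "\<bar>k t * (prob ((\<lambda>y. y + t) -` A) - prob A)\<bar> \<le> k t * \<eta>" for t
      using \<eta>[of t] k[of t] by (cases "k t = 0") (auto simp: abs_mult intro!: mult_left_mono)
  qed
  also have "\<dots> = \<eta>" using kern by simp
  finally show ?thesis .
qed

end

text \<open>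
The smoothed laws have densities that converge pointwise together with the distribution functions,
hence in \<open>L\<^sup>1\<close> by Scheffe's lemma; translation continuity controls the effect of smoothing on both sides.
\<close>
theorem cdf_convergence_imp_uniform_on_sets:
  fixes \<mu> :: "nat \<Rightarrow> real measure" and \<nu> :: "real measure"
  assumes \<mu>: "\<And>n. real_distribution (\<mu> n)" and \<nu>: "real_distribution \<nu>"
    and cdf: "\<And>x. (\<lambda>n. cdf (\<mu> n) x) \<longlonglongrightarrow> cdf \<nu> x"
    and shift_\<mu>: "\<And>\<eta>. 0 < \<eta> \<Longrightarrow> \<exists>t0>0. \<forall>\<^sub>F n in sequentially. \<forall>t\<in>{0..t0}. \<forall>A\<in>sets borel.
       \<bar>measure (\<mu> n) ((\<lambda>y. y + t) -` A) - measure (\<mu> n) A\<bar> \<le> \<eta>"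
    and shift_\<nu>: "\<And>\<eta>. 0 < \<eta> \<Longrightarrow> \<exists>t0>0. \<forall>t\<in>{0..t0}. \<forall>A\<in>sets borel.
       \<bar>measure \<nu> ((\<lambda>y. y + t) -` A) - measure \<nu> A\<bar> \<le> \<eta>"
    and e: "0 < e"
  shows "\<forall>\<^sub>F n in sequentially. \<forall>A\<in>sets borel. \<bar>measure (\<mu> n) A - measure \<nu> A\<bar> \<le> e"
proof -
  interpret \<mu>: real_distribution "\<mu> n" for n by (rule \<mu>)
  interpret \<nu>: real_distribution \<nu> by (rule \<nu>)
  obtain t1 where t1: "0 < t1" and ev1: "\<forall>\<^sub>F n in sequentially. \<forall>t\<in>{0..t1}. \<forall>A\<in>sets borel.
       \<bar>measure (\<mu> n) ((\<lambda>y. y + t) -` A) - measure (\<mu> n) A\<bar> \<le> e / 3"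
    using shift_\<mu>[of "e / 3"] e by auto
  obtain t2 where t2: "0 < t2" and sh2: "\<forall>t\<in>{0..t2}. \<forall>A\<in>sets borel.
       \<bar>measure \<nu> ((\<lambda>y. y + t) -` A) - measure \<nu> A\<bar> \<le> e / 3"
    using shift_\<nu>[of "e / 3"] e by auto
  define h where "h = min t1 t2"
  have h: "0 < h" "h \<le> t1" "h \<le> t2" using t1 t2 by (auto simp: h_def)
  let ?p = "\<lambda>n. \<mu>.smooth_density n h" and ?q = "\<nu>.smooth_density h"
  have nn: "(\<integral>\<^sup>+ x. norm (?p n x) \<partial>lborel) = 1" "(\<integral>\<^sup>+ x. norm (?q x) \<partial>lborel) = 1" for n
    using \<mu>.smooth_density_total[OF h(1), of n] \<mu>.smooth_density_nonneg[OF h(1), of n]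
      \<nu>.smooth_density_total[OF h(1)] \<nu>.smooth_density_nonneg[OF h(1)]
    by (simp_all add: nn_integral_eq_integral)
  have "(\<lambda>n. \<integral>\<^sup>+ x. norm (?p n x - ?q x) \<partial>lborel) \<longlonglongrightarrow> 0"
  proof (rule Scheffe_lemma1)
    show "AE x in lborel. (\<lambda>n. ?p n x) \<longlonglongrightarrow> ?q x"
      unfolding \<mu>.smooth_density_def \<nu>.smooth_density_def using h(1)
      by (intro AE_I2 tendsto_intros cdf) auto
    show "limsup (\<lambda>n. \<integral>\<^sup>+ x. norm (?p n x) \<partial>lborel) \<le> (\<integral>\<^sup>+ x. norm (?q x) \<partial>lborel)"
      unfolding nn by (simp add: Limsup_const)
  qed (use \<mu>.smooth_density_total \<nu>.smooth_density_total h in auto)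
  then have ev2: "\<forall>\<^sub>F n in sequentially. (\<integral>\<^sup>+ x. norm (?p n x - ?q x) \<partial>lborel) < ennreal (e / 3)"
    using e by (intro order_tendstoD) auto
  show ?thesis
    using ev1 ev2
  proof eventually_elim
    case (elim n)
    show ?case
    proof
      fix A :: "real set" assume A[measurable]: "A \<in> sets borel"
      let ?IA = "\<lambda>p. \<integral>x. indicator A x * p x \<partial>lborel"
      have intd: "integrable lborel (\<lambda>x. ?p n x - ?q x)"
        using \<mu>.smooth_density_total[OF h(1)] \<nu>.smooth_density_total[OF h(1)] by auto
      have "\<bar>?IA (?p n) - ?IA ?q\<bar> = \<bar>\<integral>x. indicator A x * (?p n x - ?q x) \<partial>lborel\<bar>"
        using \<mu>.smooth_density_integral(1)[OF h(1) A, of n] \<nu>.smooth_density_integral(1)[OF h(1) A]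
        by (simp add: right_diff_distrib)
      also have "\<dots> \<le> (\<integral>x. \<bar>indicator A x * (?p n x - ?q x)\<bar> \<partial>lborel)" by (rule integral_abs_bound)
      also have "\<dots> \<le> (\<integral>x. norm (?p n x - ?q x) \<partial>lborel)"
        using intd \<mu>.smooth_density_integral(1)[OF h(1) A, of n] \<nu>.smooth_density_integral(1)[OF h(1) A]
        by (intro integral_mono) (auto simp: right_diff_distrib split: split_indicator)
      also have "\<dots> \<le> e / 3"
        using elim(2) e intd by (subst (asm) nn_integral_eq_integral) (auto simp: ennreal_less_iff)
      finally have mid: "\<bar>?IA (?p n) - ?IA ?q\<bar> \<le> e / 3" .
      have "\<bar>?IA (?p n) - measure (\<mu> n) A\<bar> \<le> e / 3"
        by (rule \<mu>.smoothing_error[OF h(1) A]) (use elim(1) h A in auto)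
      moreover have "\<bar>?IA ?q - measure \<nu> A\<bar> \<le> e / 3"
        by (rule \<nu>.smoothing_error[OF h(1) A]) (use sh2 h A in auto)
      ultimately show "\<bar>measure (\<mu> n) A - measure \<nu> A\<bar> \<le> e" using mid by linarith
    qed
  qed
qed

section \<open>The law of the absolute value of a standard normal variable\<close>

lemma std_normal_density_antimono: "\<bar>a\<bar> \<le> \<bar>b\<bar> \<Longrightarrow> \<phi> b \<le> \<phi> a"
  by (simp add: std_normal_density_def abs_le_square_iff divide_right_mono)

locale abs_normal = prob_space N for N :: "'b measure" +
  fixes Z :: "'b \<Rightarrow> real"
  assumes Z: "distributed N lborel Z std_normal_density"
begin

lemma rv_Z [measurable]: "random_variable borel Z"
  using distributed_measurable[OF Z] by simp

lemma law_Z: "distr N borel Z = std_normal_distribution"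
  using distributed_distr_eq_density[OF Z] by (simp cong: distr_cong)

abbreviation \<nu> :: "real measure" where "\<nu> \<equiv> distr N borel (\<lambda>\<omega>. \<bar>Z \<omega>\<bar>)"

lemma real_distribution_\<nu>: "real_distribution \<nu>"
  by (intro real_distribution_distr) measurable

lemma cdf_\<nu>: "cdf \<nu> x = half_normal (max 0 x)"
proof -
  interpret S: real_distribution std_normal_distribution by (rule real_dist_normal_dist)
  have "cdf std_normal_distribution = (\<lambda>x. (half_normal x + 1) / 2)"
    by (auto simp: half_normal_def)
  then have "isCont (cdf std_normal_distribution) x" for x
    by (simp add: isCont_divide)
  then have single: "measure std_normal_distribution {x} = 0" for x
    by (simp add: S.isCont_cdf)
  have "cdf \<nu> x = measure N {\<omega>\<in>space N. \<bar>Z \<omega>\<bar> \<le> x}"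
    unfolding cdf_def by (subst measure_distr) (auto intro!: arg_cong[of _ _ prob])
  also have "\<dots> = measure (distr N borel Z) {-x..x}"
    by (subst measure_distr) (auto intro!: arg_cong[of _ _ prob])
  also have "\<dots> = measure std_normal_distribution {-x..x}" by (simp only: law_Z)
  also have "\<dots> = half_normal (max 0 x)"
  proof (cases "0 < x")
    case True
    have "{-x..x} = {-x} \<union> {-x<..x}" using True by auto
    then have "measure std_normal_distribution {-x..x} = measure std_normal_distribution {-x} + measure std_normal_distribution {-x<..x}"
      by (simp only:) (rule S.finite_measure_Union, auto)
    also have "\<dots> = cdf std_normal_distribution x - cdf std_normal_distribution (-x)"
      using True by (simp add: single S.cdf_diff_eq)
    also have "\<dots> = half_normal x"
      using half_normal_minus[of x] by (simp add: half_normal_def)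
    finally show ?thesis using True by simp
  next
    case False
    then have "{-x..x} \<subseteq> {x}" by auto
    then have "measure std_normal_distribution {-x..x} \<le> measure std_normal_distribution {x}"
      by (intro S.finite_measure_mono) auto
    then have "measure std_normal_distribution {-x..x} = 0"
      using single[of x] measure_nonneg[of std_normal_distribution "{-x..x}"] by linarith
    then show ?thesis using False by simp
  qed
  finally show ?thesis .
qed

definition half_density :: "real \<Rightarrow> real" where
  "half_density y = 2 * \<phi> y * indicator {0<..} y"

lemma borel_measurable_half_density [measurable]: "half_density \<in> borel_measurable borel"
  unfolding half_density_def by measurable

lemma integrable_half_density: "integrable lborel half_density"
  by (rule Bochner_Integration.integrable_bound[OF integrable_mult_right[of 2, OF integrable_normal_density[of 1 0]]])
    (auto simp: half_density_def split: split_indicator)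

lemma measure_\<nu>:
  assumes [measurable]: "A \<in> sets borel"
  shows "measure \<nu> A = (\<integral>y. half_density y * indicator A y \<partial>lborel)"
proof -
  let ?p = "\<lambda>z. \<phi> z * indicator A z * indicator {0<..} z" and ?q = "\<lambda>z. \<phi> z * indicator A (- z) * indicator {..<0} z"
  have int: "integrable lborel ?p" "integrable lborel ?q"
    by (rule Bochner_Integration.integrable_bound[OF integrable_normal_density[of 1 0]]; auto split: split_indicator)+
  have "measure \<nu> A = (\<integral>z. indicator A \<bar>z\<bar> \<partial>distr N borel Z)"
  proof -
    have "measure \<nu> A = (\<integral>y. indicator A y \<partial>\<nu>)" by simp
    also have "\<dots> = expectation (\<lambda>\<omega>. indicator A \<bar>Z \<omega>\<bar>)" by (rule integral_distr) auto
    also have "\<dots> = (\<integral>z. indicator A \<bar>z\<bar> \<partial>distr N borel Z)" by (rule integral_distr[symmetric]) auto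
    finally show ?thesis .
  qed
  also have "\<dots> = (\<integral>z. \<phi> z * indicator A \<bar>z\<bar> \<partial>lborel)"
    unfolding law_Z by (subst integral_density) auto
  also have "\<dots> = (\<integral>z. ?p z + ?q z \<partial>lborel)"
  proof (rule integral_cong_AE)
    show "AE z in lborel. \<phi> z * indicator A \<bar>z\<bar> = ?p z + ?q z"
      using AE_lborel_singleton[of 0] by eventually_elim (auto split: split_indicator)
  qed auto
  also have "\<dots> = integral\<^sup>L lborel ?p + integral\<^sup>L lborel ?q" using int by simp
  also have "integral\<^sup>L lborel ?q = integral\<^sup>L lborel ?p"
  proof -
    have "integral\<^sup>L lborel ?q = (\<integral>z. ?q (- z) \<partial>lborel)"
      using lborel_integral_real_affine[of "-1" ?q 0] by simp
    also have "\<dots> = integral\<^sup>L lborel ?p"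
      by (intro Bochner_Integration.integral_cong) (auto simp: std_normal_density_def split: split_indicator)
    finally show ?thesis .
  qed
  also have "integral\<^sup>L lborel ?p + integral\<^sup>L lborel ?p = (\<integral>y. 2 * ?p y \<partial>lborel)" by simp
  also have "\<dots> = (\<integral>y. half_density y * indicator A y \<partial>lborel)"
    by (intro Bochner_Integration.integral_cong) (auto simp: half_density_def)
  finally show ?thesis .
qed

text \<open>
On the half line the density decreases, so a translation to the right by \<open>t\<close> can lower it only on
\<open>[0, t]\<close>.  This bounds the loss of mass of every set; applied to the complement it also bounds the gain.
\<close>
lemma shift_\<nu>:
  assumes t: "0 \<le> t" and A: "A \<in> sets borel"
  shows "\<bar>measure \<nu> ((\<lambda>y. y + t) -` A) - measure \<nu> A\<bar> \<le> 10 * t"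
proof -
  interpret \<nu>: real_distribution \<nu> by (rule real_distribution_\<nu>)
  have shift_sets: "(\<lambda>y. y + t) -` B \<in> sets borel" if "B \<in> sets borel" for B
    using measurable_sets[of "\<lambda>y::real. y + t" borel borel B] that by simp
  have lower: "- (10 * t) \<le> measure \<nu> ((\<lambda>y. y + t) -` B) - measure \<nu> B" if [measurable]: "B \<in> sets borel" for B
  proof -
    have si: "integrable lborel (\<lambda>y. half_density (y - t))"
      using lborel_integrable_real_affine[OF integrable_half_density, of 1 "-t"] by simp
    have ii: "integrable lborel (\<lambda>y. g y * indicator B y)" if "integrable lborel g" for g :: "real \<Rightarrow> real"
      by (rule Bochner_Integration.integrable_bound[OF that]) (use that in \<open>auto split: split_indicator\<close>)
    have "measure \<nu> ((\<lambda>y. y + t) -` B) = (\<integral>y. half_density ((y + t) - t) * indicator B (y + t) \<partial>lborel)"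
      unfolding measure_\<nu>[OF shift_sets[OF that]]
      by (intro Bochner_Integration.integral_cong) (auto split: split_indicator)
    also have "\<dots> = (\<integral>y. half_density (y - t) * indicator B y \<partial>lborel)"
      by (rule lborel_integral_shift[of "\<lambda>y. half_density (y - t) * indicator B y"])
    finally have eq: "measure \<nu> ((\<lambda>y. y + t) -` B) - measure \<nu> B =
       (\<integral>y. half_density (y - t) * indicator B y - half_density y * indicator B y \<partial>lborel)"
      using ii[OF si] ii[OF integrable_half_density] by (simp add: measure_\<nu>[OF that])
    have "- (10 * t) = (\<integral>y. - 10 * indicator {0..t} y \<partial>lborel)" using t by simp
    also have "\<dots> \<le> (\<integral>y. half_density (y - t) * indicator B y - half_density y * indicator B y \<partial>lborel)"
    proof (rule integral_mono)
      show "integrable lborel (\<lambda>y. - 10 * indicator {0..t} y :: real)"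
        using t by (intro integrable_mult_right integrable_real_indicator) auto
      show "integrable lborel (\<lambda>y. half_density (y - t) * indicator B y - half_density y * indicator B y)"
        using ii[OF si] ii[OF integrable_half_density] by simp
      fix y
      show "- 10 * indicator {0..t} y \<le> half_density (y - t) * indicator B y - half_density y * indicator B y"
        using std_normal_density_antimono[of "y - t" y] std_normal_density_moment_bounds(1)[of y] t
        by (auto simp: half_density_def split: split_indicator)
    qed
    finally show ?thesis unfolding eq .
  qed
  have "measure \<nu> ((\<lambda>y. y + t) -` (- A)) = 1 - measure \<nu> ((\<lambda>y. y + t) -` A)"
    using \<nu>.prob_compl[of "(\<lambda>y. y + t) -` A"] shift_sets[OF A] by (simp add: vimage_Compl Compl_eq_Diff_UNIV vimage_Diff)
  moreover have "measure \<nu> (- A) = 1 - measure \<nu> A"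
    using \<nu>.prob_compl[of A] A by (simp add: Compl_eq_Diff_UNIV)
  ultimately show ?thesis using lower[OF A] lower[of "- A"] A by auto
qed

end

section \<open>Convergence in total variation\<close>

context standardized_density_walk
begin

theorem scaled_max_converges_on_sets:
  fixes N :: "'b measure" and Z :: "'b \<Rightarrow> real"
  assumes "prob_space N" and "distributed N lborel Z std_normal_density" and e: "0 < e"
  shows "\<forall>\<^sub>F n in sequentially. \<forall>A\<in>sets borel.
     \<bar>measure (distr M borel (\<lambda>\<omega>. max_partial_sum X n \<omega> / sqrt (real n))) A
        - measure (distr N borel (\<lambda>\<omega>. \<bar>Z \<omega>\<bar>)) A\<bar> \<le> e"
proof -
  interpret N: abs_normal N Z using assms by (simp add: abs_normal_def abs_normal_axioms_def)
  define Y where "Y n \<omega> = W n 0 \<omega> / sqrt (real n)" for n \<omega>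
  have [measurable]: "random_variable borel (Y n)" for n unfolding Y_def by measurable
  define \<mu>Y where "\<mu>Y n = distr M borel (Y n)" for n
  have meas: "measure (\<mu>Y n) A = expectation (\<lambda>\<omega>. indicator A (Y n \<omega>))" if "A \<in> sets borel" for n A
  proof -
    have "measure (\<mu>Y n) A = (\<integral>y. indicator A y \<partial>\<mu>Y n)" using that by (simp add: \<mu>Y_def)
    also have "\<dots> = expectation (\<lambda>\<omega>. indicator A (Y n \<omega>))"
      unfolding \<mu>Y_def using that by (intro integral_distr) auto
    finally show ?thesis .
  qed
  have conv: "\<forall>\<^sub>F n in sequentially. \<forall>A\<in>sets borel. \<bar>measure (\<mu>Y n) A - measure N.\<nu> A\<bar> \<le> e / 2"
  proof (rule cdf_convergence_imp_uniform_on_sets)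
    show "real_distribution (\<mu>Y n)" for n unfolding \<mu>Y_def by (intro real_distribution_distr) measurable
    show "real_distribution N.\<nu>" by (rule N.real_distribution_\<nu>)
    show "0 < e / 2" using e by simp
    show "\<exists>t0>0. \<forall>t\<in>{0..t0}. \<forall>A\<in>sets borel. \<bar>measure N.\<nu> ((\<lambda>y. y + t) -` A) - measure N.\<nu> A\<bar> \<le> \<eta>" if "0 < \<eta>" for \<eta>
    proof (intro exI conjI ballI)
      show "0 < \<eta> / 10" using that by simp
      fix t :: real and A :: "real set" assume "t \<in> {0..\<eta> / 10}" "A \<in> sets borel"
      then show "\<bar>measure N.\<nu> ((\<lambda>y. y + t) -` A) - measure N.\<nu> A\<bar> \<le> \<eta>"
        using N.shift_\<nu>[of t A] by auto
    qed
    show "(\<lambda>n. cdf (\<mu>Y n) x) \<longlonglongrightarrow> cdf N.\<nu> x" for x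
    proof -
      have cdfY: "cdf (\<mu>Y n) x = prob {\<omega>\<in>space M. W n 0 \<omega> \<le> x * sqrt (real n)}" if "0 < n" for n
        unfolding cdf_def \<mu>Y_def using that
        by (subst measure_distr) (auto simp: Y_def pos_divide_le_eq intro!: arg_cong[of _ _ prob])
      have "(\<lambda>n. prob {\<omega>\<in>space M. W n 0 \<omega> \<le> x * sqrt (real n)}) \<longlonglongrightarrow> half_normal (max 0 x)"
      proof (cases "0 \<le> x")
        case True
        then show ?thesis using W_cdf_limit[OF True] by simp
      next
        case False
        have "\<forall>\<^sub>F n in sequentially. prob {\<omega>\<in>space M. W n 0 \<omega> \<le> x * sqrt (real n)} = 0"
          using eventually_gt_at_top[of "0::nat"]
          by eventually_elim (use False in \<open>auto intro!: W_cdf_neg mult_neg_pos\<close>)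
        then have "(\<lambda>n. prob {\<omega>\<in>space M. W n 0 \<omega> \<le> x * sqrt (real n)}) \<longlonglongrightarrow> 0"
          by (rule tendsto_eventually)
        then show ?thesis using False by simp
      qed
      moreover have "\<forall>\<^sub>F n in sequentially. prob {\<omega>\<in>space M. W n 0 \<omega> \<le> x * sqrt (real n)} = cdf (\<mu>Y n) x"
        using eventually_gt_at_top[of "0::nat"] by eventually_elim (simp add: cdfY)
      ultimately show ?thesis unfolding N.cdf_\<nu> by (rule Lim_transform_eventually)
    qed
    fix \<eta> :: real assume \<eta>: "0 < \<eta>"
    obtain t0 where t0: "0 < t0"
      "\<forall>\<^sub>F n in sequentially. \<forall>t (g :: real \<Rightarrow> real). 0 \<le> t \<longrightarrow> t \<le> t0 \<longrightarrow> g \<in> borel_measurable borel \<longrightarrow> (\<forall>x. \<bar>g x\<bar> \<le> 1) \<longrightarrow>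
       \<bar>expectation (\<lambda>\<omega>. g (Y n \<omega> + t)) - expectation (\<lambda>\<omega>. g (Y n \<omega>))\<bar> \<le> \<eta>"
      by (rule asymptotic_shift_continuity[OF \<eta>, folded Y_def]) (rule that; assumption)
    have "\<forall>\<^sub>F n in sequentially. \<forall>t\<in>{0..t0}. \<forall>A\<in>sets borel.
       \<bar>measure (\<mu>Y n) ((\<lambda>y. y + t) -` A) - measure (\<mu>Y n) A\<bar> \<le> \<eta>"
      using t0(2)
    proof eventually_elim
      case (elim n)
      show ?case
      proof (intro ballI)
        fix t :: real and A :: "real set" assume t: "t \<in> {0..t0}" and A: "A \<in> sets borel"
        have s: "(\<lambda>y. y + t) -` A \<in> sets borel"
          using measurable_sets[of "\<lambda>y::real. y + t" borel borel A] A by simp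
        have "indicator ((\<lambda>y. y + t) -` A) y = (indicator A (y + t) :: real)" for y by (auto split: split_indicator)
        then show "\<bar>measure (\<mu>Y n) ((\<lambda>y. y + t) -` A) - measure (\<mu>Y n) A\<bar> \<le> \<eta>"
          unfolding meas[OF s] meas[OF A] using elim[rule_format, of t "indicator A"] t A by simp
      qed
    qed
    with t0(1) show "\<exists>t0>0. \<forall>\<^sub>F n in sequentially. \<forall>t\<in>{0..t0}. \<forall>A\<in>sets borel.
       \<bar>measure (\<mu>Y n) ((\<lambda>y. y + t) -` A) - measure (\<mu>Y n) A\<bar> \<le> \<eta>" by blast
  qed
  have "(\<lambda>n. prob {\<omega>\<in>space M. W n 0 \<omega> \<le> 0}) \<longlonglongrightarrow> 0"
    using W_cdf_limit[of 0] by simp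
  then have zero: "\<forall>\<^sub>F n in sequentially. prob {\<omega>\<in>space M. W n 0 \<omega> \<le> 0} < e / 4"
    using e by (intro order_tendstoD) auto
  show ?thesis
    using conv zero eventually_ge_at_top[of "1::nat"]
  proof eventually_elim
    case (elim n)
    let ?m = "\<lambda>\<omega>. max_partial_sum X n \<omega>"
    have [measurable]: "random_variable borel ?m"
      unfolding max_partial_sum_def using elim(3) by (intro borel_measurable_Max) auto
    have Wm: "W n 0 \<omega> = max 0 (?m \<omega>)" for \<omega> using max_partial_sum_eq_W[OF elim(3)] by simp
    show ?case
    proof
      fix A :: "real set" assume A[measurable]: "A \<in> sets borel"
      have "measure (distr M borel (\<lambda>\<omega>. ?m \<omega> / sqrt (real n))) A = (\<integral>y. indicator A y \<partial>distr M borel (\<lambda>\<omega>. ?m \<omega> / sqrt (real n)))"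
        by simp
      also have "\<dots> = expectation (\<lambda>\<omega>. indicator A (?m \<omega> / sqrt (real n)))"
        by (rule integral_distr) auto
      finally have m: "measure (distr M borel (\<lambda>\<omega>. ?m \<omega> / sqrt (real n))) A = \<dots>" .
      have "\<bar>expectation (\<lambda>\<omega>. indicator A (?m \<omega> / sqrt (real n))) - expectation (\<lambda>\<omega>. indicator A (Y n \<omega>))\<bar>
        \<le> 2 * prob {\<omega>\<in>space M. W n 0 \<omega> \<le> 0}"
        by (rule coupling_inequality) (auto simp: Y_def Wm max_def split: if_splits)
      then show "\<bar>measure (distr M borel (\<lambda>\<omega>. ?m \<omega> / sqrt (real n))) A - measure N.\<nu> A\<bar> \<le> e"
        using bspec[OF elim(1) A] elim(2) unfolding m meas[OF A, symmetric] by linarith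
    qed
  qed
qed

end

text \<open>
The density is given with values in \<open>ennreal\<close>; it is finite almost everywhere and may be replaced by a
real-valued version.  The square of a step is integrable because otherwise its integral would be \<open>0\<close>
instead of \<open>1\<close>.
\<close>
theorem theorem1p2:
  fixes M :: "'a measure" and N :: "'b measure"
    and X :: "nat \<Rightarrow> 'a \<Rightarrow> real" and Z :: "'b \<Rightarrow> real"
  assumes "prob_space M"
    and "prob_space.indep_vars M (\<lambda>_. borel) X {1..}"
    and "\<And>k. k \<ge> 1 \<Longrightarrow> distr M borel (X k) = distr M borel (X 1)"
    and "\<exists>f. distributed M lborel (X 1) f"
    and "prob_space.expectation M (X 1) = 0"
    and "prob_space.expectation M (\<lambda>\<omega>. (X 1 \<omega>)\<^sup>2) = 1"
    and "prob_space N"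
    and "distributed N lborel Z std_normal_density"
  shows "(\<lambda>n. d_TV M (\<lambda>\<omega>. max_partial_sum X n \<omega> / sqrt (real n)) N (\<lambda>\<omega>. \<bar>Z \<omega>\<bar>)) \<longlonglongrightarrow> 0"
proof -
  interpret M: prob_space M by fact
  interpret N: prob_space N by fact
  have X1 [measurable]: "X 1 \<in> borel_measurable M"
    using assms(2) by (auto simp: M.indep_vars_def)
  obtain f0 where f0: "distributed M lborel (X 1) f0" using assms(4) by blast
  have f0m [measurable]: "f0 \<in> borel_measurable borel"
    using distributed_borel_measurable[OF f0] by simp
  have law0: "distr M borel (X 1) = density lborel f0"
    using distributed_distr_eq_density[OF f0] by (simp cong: distr_cong)
  define f where "f x = enn2real (f0 x)" for x
  have fin: "AE x in lborel. f0 x = ennreal (f x)"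
  proof -
    interpret D: prob_space "distr M borel (X 1)" by (rule M.prob_space_distr) (rule X1)
    have "(\<integral>\<^sup>+ x. f0 x \<partial>lborel) = emeasure (distr M borel (X 1)) UNIV"
      unfolding law0 by (subst emeasure_density) auto
    also have "\<dots> = 1" using D.emeasure_space_1 by simp
    finally have "AE x in lborel. f0 x \<noteq> \<infinity>" by (intro nn_integral_noteq_infinite) auto
    then show ?thesis by eventually_elim (auto simp: f_def less_top)
  qed
  have law: "distr M borel (X 1) = density lborel (\<lambda>x. ennreal (f x))"
    unfolding law0 using fin by (intro density_cong) (auto simp: f_def)
  have std: "standardized_law (distr M borel (X 1))"
  proof -
    have "integrable M (\<lambda>\<omega>. (X 1 \<omega>)\<^sup>2)"
      using assms(6) not_integrable_integral_eq by fastforce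
    then have "integrable (distr M borel (X 1)) (\<lambda>x. x\<^sup>2)"
      using X1 by (subst integrable_distr_eq) auto
    moreover have "(\<integral>x. x \<partial>distr M borel (X 1)) = 0" "(\<integral>x. x\<^sup>2 \<partial>distr M borel (X 1)) = 1"
      using assms(5,6) X1 by (auto simp: integral_distr)
    ultimately show ?thesis
      by (intro standardized_law.intro standardized_law_axioms.intro M.real_distribution_distr X1)
  qed
  have iid: "iid_walk M X"
    by (intro iid_walk.intro iid_walk_axioms.intro assms(1,2)) (rule assms(3))
  have "f \<in> borel_measurable borel" "0 \<le> f x" for x
    by (auto simp: f_def[abs_def])
  then interpret standardized_density_walk M X f
    by (intro standardized_density_walk.intro density_walk.intro density_walk_axioms.intro
        standardized_walk.intro standardized_walk_axioms.intro iid std law)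
  show ?thesis
  proof (rule tendstoI)
    fix e :: real assume e: "0 < e"
    then have "0 < e / 4" by simp
    from scaled_max_converges_on_sets[OF assms(7,8) this] eventually_ge_at_top[of "1::nat"]
    show "\<forall>\<^sub>F n in sequentially. dist (d_TV M (\<lambda>\<omega>. max_partial_sum X n \<omega> / sqrt (real n)) N (\<lambda>\<omega>. \<bar>Z \<omega>\<bar>)) 0 < e"
    proof eventually_elim
      case (elim n)
      have Zm: "Z \<in> borel_measurable N" using distributed_measurable[OF assms(8)] by simp
      have mm: "max_partial_sum X n \<in> borel_measurable M"
        unfolding max_partial_sum_def using elim(2) by (intro borel_measurable_Max) auto
      have "finite_measure (distr M borel (\<lambda>\<omega>. max_partial_sum X n \<omega> / sqrt (real n)))"
        "finite_measure (distr N borel (\<lambda>\<omega>. \<bar>Z \<omega>\<bar>))"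
        using Zm mm by (auto intro!: M.finite_measure_distr N.finite_measure_distr)
      from tv_norm_diff_bounds[OF this, of "e / 4"] elim(1) e show ?case
        by (simp add: d_TV_def dist_real_def)
    qed
  qed
qed

end
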